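(* Let $n\ge1$, let $0<u\le\infty$, and let $p,q$ satisfy $$0<\frac{n-1}{n}\,p<q\le p<\infty.$$ If $0<t<\min(q,u)$, then there is a constant $C>0$ such that $$\left\|\left(\sum_{j=1}^\infty[\mathcal M_tf_j]^u\right)^{1/u}\right\|_{\mathcal M^p_q(\mathbb R^n)}\le C\left\|\left(\sum_{j=1}^\infty|f_j|^u\right)^{1/u}\right\|_{\mathcal M^p_q(\mathbb R^n)}$$ for every sequence $\{f_j\}_{j=1}^\infty\subset\mathcal M^p_q(\mathbb R^n)$ (with $\left(\sum_j|a_j|^u\right)^{1/u}$ replaced by $\sup_j|a_j|$ when $u=\infty$).
   Context: For $0<q\le p<\infty$ the (classical) Morrey norm of a measurable function $f$ on $\mathbb R^n$ is $$\|f\|_{\mathcal M^p_q(\mathbb R^n)}=\sup_Q|Q|^{\frac1p-\frac1q}\left(\int_Q|f(x)|^q\,dx\right)^{1/q},$$ the supremum being over all cubes $Q\subset\mathbb R^n$ with sides parallel to the coordinate axes; $\mathcal M^p_q(\mathbb R^n)$ is the set of measurable $f$ for which it is finite. For $1\le k\le n$ the one-dimensional maximal operator in the $k$-th variable is $M_kf(x)=\sup_{I\ni x_k}\frac1{|I|}\int_I|f(x_1,\ldots,y_k,\ldots,x_n)|\,dy_k$ (supremum over intervals $I\subset\mathbb R$ containing $x_k$). For $t>0$ the iterated maximal operator is $\mathcal M_tf(x)=\left(M_n\cdots M_1[|f|^t](x)\right)^{1/t}$. *)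

theory Defs
  imports "HOL-Analysis.Analysis"
begin

text \<open>
  Maximal functions may be infinite at some points, so after taking absolute values all
  functions are \<^typ>\<open>ennreal\<close>-valued. The power below is only meant for exponents \<open>a > 0\<close>.
\<close>

definition ennpowr :: "ennreal \<Rightarrow> real \<Rightarrow> ennreal" where
  "ennpowr x a = (if x = \<infinity> then \<infinity> else ennreal (enn2real x powr a))"

definition axis_cubes :: "(real^'n) set set" where
  "axis_cubes = {cbox a (\<chi> i. a $ i + l) | a l. 0 < l}"

definition morrey_norm :: "real \<Rightarrow> real \<Rightarrow> (real^'n \<Rightarrow> ennreal) \<Rightarrow> ennreal" where
  "morrey_norm p q g =
     (SUP Q\<in>axis_cubes.
        ennreal (measure lebesgue Q powr (1 / p - 1 / q)) *
        ennpowr (\<integral>\<^sup>+x\<in>Q. ennpowr (g x) q \<partial>lebesgue) (1 / q))"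

definition morrey_space :: "real \<Rightarrow> real \<Rightarrow> (real^'n \<Rightarrow> complex) set" where
  "morrey_space p q =
     {f. f \<in> borel_measurable lebesgue \<and> morrey_norm p q (\<lambda>x. ennreal (norm (f x))) < \<infinity>}"

text \<open>
  For Lebesgue measurable \<open>F\<close> almost every line gives a measurable slice; the values on the
  remaining lines only affect the maximal function on a null set.
\<close>

definition dir_maximal :: "'n::finite \<Rightarrow> (real^'n::finite \<Rightarrow> ennreal) \<Rightarrow> real^'n::finite \<Rightarrow> ennreal" where
  "dir_maximal k F x =
     (SUP (a, b)\<in>{(a, b). a < b \<and> x $ k \<in> {a..b}}.
        (\<integral>\<^sup>+y\<in>{a..b}. F (\<chi> i. if i = k then y else x $ i) \<partial>lebesgue) / ennreal (b - a))"

text \<open>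
  The linear order of the index type provides the numbering \<open>1, \<dots>, n\<close> of the coordinates;
  \<^const>\<open>fold\<close> applies the operator belonging to the first coordinate first.
\<close>

definition iter_maximal ::
    "real \<Rightarrow> (real^'n::{finite,linorder} \<Rightarrow> complex) \<Rightarrow> real^'n::{finite,linorder} \<Rightarrow> ennreal" where
  "iter_maximal t f x =
     ennpowr (fold dir_maximal (sorted_list_of_set UNIV)
                (\<lambda>y. ennreal (norm (f y) powr t)) x) (1 / t)"

definition ell_norm :: "ennreal \<Rightarrow> (nat \<Rightarrow> ennreal) \<Rightarrow> ennreal" where
  "ell_norm u a =
     (if u = \<infinity> then (SUP j. a j)
      else ennpowr (\<Sum>j. ennpowr (a j) (enn2real u)) (1 / enn2real u))"

end

theory Submission
  imports Defs
begin

text \<open>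
  Put \<open>r = q / t > 1\<close>, \<open>U = u / t > 1\<close> and \<open>g\<^sub>j = |f\<^sub>j|\<^sup>t\<close>. After raising to the power \<open>q\<close>, the claim is
  an \<open>l\<^sup>U\<close>-valued bound for the composition of the one-dimensional maximal operators applied
  to \<open>g\<^sub>j\<close>. It is derived from a weighted \<open>L\<^sup>r\<close> bound on the whole space. For a cube with corner
  \<open>c\<close> and side \<open>l\<close> the weight is the product over the coordinates of \<open>(l + |x\<^sub>i - c\<^sub>i|)\<close> to the
  power \<open>- \<eta>\<close>. The exponent \<open>\<eta>\<close> lies strictly between \<open>\<beta> = n (1 - q / p)\<close> and \<open>1\<close>, and this is
  where the hypothesis \<open>q > (n - 1) p / n\<close> enters, since it says \<open>\<beta> < 1\<close>.

  Because \<open>\<eta> < 1\<close>, every factor of the weight is an \<open>A\<^sub>1\<close> weight on the line, with a constant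
  independent of \<open>c\<close> and \<open>l\<close> (\<open>decay_weight_A1\<close>). The weighted bound can therefore be proved for
  one coordinate at a time (\<open>nn_integral_along_lines\<close>, \<open>dir_maximal_rat_weighted\<close>) and iterated.
  Because \<open>\<eta> > \<beta>\<close>, the weighted integral of a function with finite Morrey norm converges: the
  weight is dominated by a sum over the cubes of side comparable to \<open>2\<^sup>m l\<close>, whose
  contributions form a geometric series (\<open>cube_weight_integral_bound\<close>). On the cube itself the
  weight is bounded below, which returns the Morrey norm of the left-hand side.

  On the line, an \<open>A\<^sub>1\<close> weight \<open>w\<close> allows Lebesgue averages to be replaced by averages with
  respect to \<open>w dx\<close>. It remains to bound the maximal operator \<open>M\<^sub>w\<close> of the measure \<open>w dx\<close> on
  \<open>L\<^sup>r(w; l\<^sup>U)\<close>, for an arbitrary density \<open>w\<close> and with a constant independent of it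
  (\<open>vector_weighted_maximal\<close>). The scalar case is a covering argument combined with the layer
  cake formula. The sequence-valued case is clear for \<open>r = U\<close> (sum over \<open>j\<close>) and for
  \<open>U = \<infinity>\<close> (monotonicity). Other exponents are reduced to \<open>r = U\<close> by extrapolation: if
  \<open>M\<^sub>w s \<le> K s\<close>, then averages with respect to \<open>w dx\<close> are controlled by averages with respect to
  \<open>s w dx\<close> (\<open>weighted_maximal_change_weight\<close>), and \<open>s\<close> may be chosen above any prescribed function
  at the cost of a constant factor in its weighted norm (\<open>maximal_majorant\<close>).
\<close>

section \<open>Extended nonnegative arithmetic and powers\<close>

lemma ennreal_le_suminf: "f m \<le> (\<Sum>m. f m :: ennreal)"
  using sum_le_suminf[of f "{m}"] by simp

lemma prod_mono_ennreal:
  fixes f g :: "'i \<Rightarrow> ennreal"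
  assumes "\<And>i. i \<in> A \<Longrightarrow> f i \<le> g i" shows "prod f A \<le> prod g A"
  using assms by (induction A rule: infinite_finite_induct) (auto intro: mult_mono)

lemma ennreal_mult_divide_self_le: "(c::ennreal) * b / b \<le> c"
  by (cases "b = 0 \<or> b = top") (auto simp: ennreal_mult_divide_eq ennreal_divide_top)

lemma ennreal_less_divide_imp: "(l::ennreal) < a / b \<Longrightarrow> l * b \<le> a"
proof -
  assume l: "l < a / b"
  then have "b \<noteq> top" "a \<noteq> 0" by auto
  show ?thesis
  proof (cases "b = 0")
    case False
    have "l * b \<le> (a / b) * b" using l by (intro mult_right_mono) auto
    also have "\<dots> = a"
      using False \<open>b \<noteq> top\<close> by (simp add: ennreal_divide_times ennreal_divide_self less_top)
    finally show ?thesis .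
  qed simp
qed

text \<open>
  The factor \<open>f\<close> is kept apart so that an average of the form \<open>f / b\<close> can be uncovered
  directly from a quotient of products.
\<close>

lemma ennreal_divide_cancel:
  fixes a b c f :: ennreal
  assumes "c \<noteq> 0" "c \<noteq> top" shows "a * c * f / (b * c) = a * (f / b)"
proof -
  have inv: "inverse (b * c) = inverse b * inverse c"
    using assms by (intro ennreal_inverse_mult') (auto simp: less_top zero_less_iff_neq_zero)
  have 1: "c * inverse c = 1"
    using assms ennreal_divide_self[of c] by (simp add: divide_ennreal_def less_top)
  have "a * c * f / (b * c) = a * (f * inverse b) * (c * inverse c)"
    unfolding divide_ennreal_def inv by (simp only: ac_simps)
  then show ?thesis unfolding 1 by (simp add: divide_ennreal_def)
qed

lemma ennpowr_ennreal: "0 \<le> x \<Longrightarrow> ennpowr (ennreal x) a = ennreal (x powr a)"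
  by (simp add: ennpowr_def)

lemma ennpowr_top [simp]: "ennpowr top a = top"
  by (simp add: ennpowr_def infinity_ennreal_def)

lemma ennpowr_0 [simp]: "ennpowr 0 a = 0"
  by (simp add: ennpowr_def)

lemma ennpowr_1 [simp]: "ennpowr x 1 = x"
  by (cases x) (auto simp: ennpowr_ennreal)

lemma ennpowr_mono: "0 \<le> a \<Longrightarrow> x \<le> y \<Longrightarrow> ennpowr x a \<le> ennpowr y a"
  by (cases x; cases y) (auto simp: ennpowr_ennreal intro!: ennreal_leI powr_mono2 simp: top_unique)

lemma ennpowr_mult: "0 < a \<Longrightarrow> ennpowr (x * y) a = ennpowr x a * ennpowr y a"
  by (cases x; cases y)
     (auto simp: ennpowr_ennreal powr_mult ennreal_mult_top ennreal_top_mult simp flip: ennreal_mult)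

lemma ennpowr_ennpowr: "ennpowr (ennpowr x a) b = ennpowr x (a * b)"
  by (cases x) (auto simp: ennpowr_ennreal powr_powr)

lemma ennpowr_add: "ennpowr x (a + b) = ennpowr x a * ennpowr x b"
  by (cases x) (auto simp: ennpowr_ennreal powr_add ennreal_mult_top simp flip: ennreal_mult)

lemma ennpowr_measurable [measurable (raw)]:
  assumes [measurable]: "f \<in> borel_measurable M"
  shows "(\<lambda>x. ennpowr (f x) a) \<in> borel_measurable M"
  unfolding ennpowr_def infinity_ennreal_def by measurable

text \<open>
  Taking powers is an order isomorphism with inverse power \<open>1 / a\<close>; continuity along suprema
  is a consequence.
\<close>

lemma ennpowr_le_iff:
  assumes "0 < a" shows "ennpowr x a \<le> y \<longleftrightarrow> x \<le> ennpowr y (1 / a)"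
  using ennpowr_mono[of "1 / a" "ennpowr x a" y] ennpowr_mono[of a x "ennpowr y (1 / a)"] assms
  by (auto simp: ennpowr_ennpowr)

lemma ennpowr_SUP:
  assumes a: "0 < a" shows "ennpowr (SUP i\<in>I. f i) a = (SUP i\<in>I. ennpowr (f i) a)"
proof (rule antisym)
  show "(SUP i\<in>I. ennpowr (f i) a) \<le> ennpowr (SUP i\<in>I. f i) a"
    using a by (intro SUP_least ennpowr_mono SUP_upper) auto
  show "ennpowr (SUP i\<in>I. f i) a \<le> (SUP i\<in>I. ennpowr (f i) a)"
    unfolding ennpowr_le_iff[OF a]
    by (intro SUP_least) (auto simp flip: ennpowr_le_iff[OF a] intro: SUP_upper)
qed

lemma ennpowr_eq_top_iff [simp]: "ennpowr x a = top \<longleftrightarrow> x = top"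
  by (cases x) (auto simp: ennpowr_ennreal)

lemma ennpowr_eq_0_iff [simp]: "ennpowr x a = 0 \<longleftrightarrow> x = 0"
  by (cases x) (auto simp: ennpowr_ennreal)

lemma ell_norm_mono:
  assumes "0 < u" "\<And>j. a j \<le> b j" shows "ell_norm u a \<le> ell_norm u b"
  using assms unfolding ell_norm_def
  by (auto intro!: SUP_mono' ennpowr_mono suminf_le)

lemma ell_norm_measurable [measurable (raw)]:
  assumes "\<And>j. f j \<in> borel_measurable M"
  shows "(\<lambda>x. ell_norm u (\<lambda>j. f j x)) \<in> borel_measurable M"
  using assms unfolding ell_norm_def by (cases "u = \<infinity>") (simp_all, measurable)

lemma ell_norm_upper:
  assumes "0 < u" shows "a j \<le> ell_norm u a"
proof (cases "u = \<infinity>")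
  case True then show ?thesis by (auto simp: ell_norm_def intro: SUP_upper)
next
  case False
  then have u: "0 < enn2real u" using assms by (simp add: enn2real_positive_iff less_top)
  have "ennpowr (a j) (enn2real u) \<le> (\<Sum>j. ennpowr (a j) (enn2real u))"
    by (rule ennreal_le_suminf)
  then show ?thesis using u False by (simp add: ell_norm_def ennpowr_le_iff)
qed

lemma ell_norm_ennpowr:
  assumes "0 < t" "0 < u"
  shows "ell_norm u (\<lambda>j. ennpowr (a j) (1 / t)) = ennpowr (ell_norm (u / ennreal t) a) (1 / t)"
proof (cases "u = \<infinity>")
  case True then show ?thesis
    using assms by (simp add: ell_norm_def ennpowr_SUP ennreal_top_divide)
next
  case False
  then obtain v where v: "u = ennreal v" "0 \<le> v" by (cases u) auto
  with assms have "0 < v" by simp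
  then show ?thesis using assms v
    by (simp add: ell_norm_def ennpowr_ennpowr divide_ennreal)
qed

lemma ell_norm_mult:
  assumes "0 < u" shows "ell_norm u (\<lambda>j. c * a j) = c * ell_norm u a"
proof (cases "u = \<infinity>")
  case True then show ?thesis by (simp add: ell_norm_def SUP_mult_left_ennreal)
next
  case False
  then have "0 < enn2real u" using assms by (simp add: enn2real_positive_iff less_top)
  with False show ?thesis
    by (simp add: ell_norm_def ennpowr_mult ennpowr_ennpowr)
qed

lemma ell_norm_real:
  "0 < u \<Longrightarrow> ell_norm (ennreal u) a = ennpowr (\<Sum>j. ennpowr (a j) u) (1 / u)"
  by (simp add: ell_norm_def)

lemma ennpowr_ell_norm_real:
  "0 < u \<Longrightarrow> ennpowr (ell_norm (ennreal u) a) u = (\<Sum>j. ennpowr (a j) u)"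
  by (simp add: ell_norm_real ennpowr_ennpowr)

section \<open>Maximal operators with respect to a weight on the line\<close>

text \<open>
  A subcover of minimal cardinality works. If a point lay in three of its intervals, then the
  one reaching furthest to the left and the one reaching furthest to the right would cover
  any third one, which could be dropped.
\<close>

lemma interval_subcover:
  fixes a b :: "'i \<Rightarrow> real"
  assumes "finite F"
  shows "\<exists>G\<subseteq>F. (\<Union>i\<in>G. {a i..b i}) = (\<Union>i\<in>F. {a i..b i}) \<and>
           (\<forall>x. card {i\<in>G. x \<in> {a i..b i}} \<le> 2)"
proof -
  define P where "P G \<longleftrightarrow> G \<subseteq> F \<and> (\<Union>i\<in>G. {a i..b i}) = (\<Union>i\<in>F. {a i..b i})" for G
  have "P F" by (simp add: P_def)
  then obtain G where G: "P G" and min: "\<And>H. P H \<Longrightarrow> card G \<le> card H"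
    using ex_has_least_nat[of P F card] by blast
  have fin: "finite G" using G assms by (auto simp: P_def intro: finite_subset)
  have "card {i\<in>G. x \<in> {a i..b i}} \<le> 2" for x
  proof (rule ccontr)
    define S where "S = {i\<in>G. x \<in> {a i..b i}}"
    assume "\<not> card {i\<in>G. x \<in> {a i..b i}} \<le> 2"
    then have 3: "card S > 2" by (simp add: S_def)
    have S: "finite S" using fin by (simp add: S_def)
    have "S \<noteq> {}" using 3 by auto
    note S = S this
    obtain i where i: "i \<in> S" "\<And>m. m \<in> S \<Longrightarrow> a i \<le> a m"
      using S arg_min_if_finite(1)[of S a] arg_min_least[of S _ a] by metis
    obtain j where j: "j \<in> S" "\<And>m. m \<in> S \<Longrightarrow> b m \<le> b j"
      using S arg_min_if_finite(1)[of S "\<lambda>i. - b i"] arg_min_least[of S _ "\<lambda>i. - b i"]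
      by (metis neg_le_iff_le)
    have "\<not> S \<subseteq> {i, j}"
    proof
      assume "S \<subseteq> {i, j}"
      then have "card S \<le> card {i, j}" by (intro card_mono) auto
      also have "\<dots> \<le> 2" by (simp add: card_insert_le_m1)
      finally show False using 3 by simp
    qed
    then obtain k where k: "k \<in> S" "k \<noteq> i" "k \<noteq> j" by blast
    have "{a k..b k} \<subseteq> {a i..b i} \<union> {a j..b j}"
      using i(1) j(1) i(2)[OF k(1)] j(2)[OF k(1)] unfolding S_def by fastforce
    moreover have "i \<in> G - {k}" "j \<in> G - {k}" using i(1) j(1) k by (auto simp: S_def)
    ultimately have "(\<Union>m\<in>G. {a m..b m}) \<subseteq> (\<Union>m\<in>G - {k}. {a m..b m})" by blast
    then have "P (G - {k})" using G unfolding P_def by blast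
    then have "card G \<le> card (G - {k})" by (rule min)
    moreover have "k \<in> G" using k by (simp add: S_def)
    ultimately show False using fin by (metis card_Diff1_less not_less)
  qed
  then show ?thesis using G unfolding P_def by blast
qed

text \<open>
  Countably many intervals keep maximal functions measurable and give access to finite
  subcovers. The enumeration also contains degenerate and empty intervals.
\<close>

definition rat_interval :: "nat \<Rightarrow> real set" where
  "rat_interval n = (case from_nat n of (a :: rat, b :: rat) \<Rightarrow> {of_rat a..of_rat b})"

text \<open>
  The maximal operator of the measure \<open>w dx\<close>. Intervals of measure zero or infinity contribute
  nothing: the quotient is \<open>0 / 0 = 0\<close> in the first case and a division by \<open>\<infinity>\<close> in the second.
\<close>

definition weighted_maximal :: "(real \<Rightarrow> ennreal) \<Rightarrow> (real \<Rightarrow> ennreal) \<Rightarrow> real \<Rightarrow> ennreal" where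
  "weighted_maximal w f x = (SUP n. indicator (rat_interval n) x *
     ((\<integral>\<^sup>+y\<in>rat_interval n. f y * w y \<partial>lborel) / (\<integral>\<^sup>+y\<in>rat_interval n. w y \<partial>lborel)))"

lemma rat_interval_measurable [measurable]: "rat_interval n \<in> sets borel"
  by (simp add: rat_interval_def split: prod.split)

lemma weighted_maximal_measurable [measurable]:
  "weighted_maximal w f \<in> borel_measurable borel"
  unfolding weighted_maximal_def by measurable

lemma weighted_maximal_mono:
  "(\<And>y. f y \<le> g y) \<Longrightarrow> weighted_maximal w f x \<le> weighted_maximal w g x"
  unfolding weighted_maximal_def
  by (intro SUP_mono' mult_left_mono divide_right_mono_ennreal nn_integral_mono mult_right_mono) auto

lemma weighted_maximal_upper:
  "x \<in> rat_interval n \<Longrightarrow>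
    (\<integral>\<^sup>+y\<in>rat_interval n. f y * w y \<partial>lborel) / (\<integral>\<^sup>+y\<in>rat_interval n. w y \<partial>lborel)
      \<le> weighted_maximal w f x"
  unfolding weighted_maximal_def by (rule SUP_upper2[of n]) auto

lemma weighted_maximal_least:
  assumes "\<And>n. x \<in> rat_interval n \<Longrightarrow>
    (\<integral>\<^sup>+y\<in>rat_interval n. f y * w y \<partial>lborel) / (\<integral>\<^sup>+y\<in>rat_interval n. w y \<partial>lborel) \<le> c"
  shows "weighted_maximal w f x \<le> c"
  unfolding weighted_maximal_def using assms by (auto intro!: SUP_least split: split_indicator)

text \<open>
  The part of \<open>f\<close> below the height \<open>l\<close> has averages at most \<open>l\<close>; this feeds the truncation of
  \<open>f\<close> at its own height into the weak type bound, as in Marcinkiewicz interpolation.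
\<close>

lemma weighted_maximal_split:
  assumes [measurable]: "f \<in> borel_measurable borel" "w \<in> borel_measurable borel"
  shows "weighted_maximal w f x \<le> weighted_maximal w (\<lambda>y. f y * indicator {y. l < f y} y) x + l"
proof (rule weighted_maximal_least)
  fix n assume x: "x \<in> rat_interval n"
  let ?J = "rat_interval n" and ?g = "\<lambda>y. f y * indicator {y. l < f y} y"
  let ?B = "\<integral>\<^sup>+y\<in>?J. w y \<partial>lborel"
  have "(\<integral>\<^sup>+y\<in>?J. f y * w y \<partial>lborel) \<le> (\<integral>\<^sup>+y. ?g y * w y * indicator ?J y + l * (w y * indicator ?J y) \<partial>lborel)"
    by (intro nn_integral_mono) (auto split: split_indicator intro: mult_right_mono)
  also have "\<dots> = (\<integral>\<^sup>+y\<in>?J. ?g y * w y \<partial>lborel) + l * ?B"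
    by (simp add: nn_integral_add nn_integral_cmult)
  finally have "(\<integral>\<^sup>+y\<in>?J. f y * w y \<partial>lborel) / ?B \<le> ((\<integral>\<^sup>+y\<in>?J. ?g y * w y \<partial>lborel) + l * ?B) / ?B"
    by (rule divide_right_mono_ennreal)
  also have "\<dots> = (\<integral>\<^sup>+y\<in>?J. ?g y * w y \<partial>lborel) / ?B + l * ?B / ?B"
    by (simp add: divide_ennreal_def distrib_right)
  also have "\<dots> \<le> weighted_maximal w ?g x + l"
    by (intro add_mono weighted_maximal_upper x ennreal_mult_divide_self_le)
  finally show "(\<integral>\<^sup>+y\<in>?J. f y * w y \<partial>lborel) / ?B \<le> weighted_maximal w ?g x + l" .
qed

text \<open>
  The level set is an increasing union of finite unions of intervals on which the average
  exceeds \<open>l\<close>. A subcover of multiplicity two bounds the measure of each finite union, and the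
  factor 2 is that multiplicity. The argument sees the measure \<open>w dx\<close> only through its values on
  intervals, so the constant is universal.
\<close>

lemma weighted_maximal_weak_type:
  assumes [measurable]: "f \<in> borel_measurable borel" "w \<in> borel_measurable borel"
  shows "l * (\<integral>\<^sup>+x. w x * indicator {x. l < weighted_maximal w f x} x \<partial>lborel)
           \<le> 2 * (\<integral>\<^sup>+x. f x * w x \<partial>lborel)"
proof -
  define A where "A n = {n'. n' < n \<and> l < (\<integral>\<^sup>+y\<in>rat_interval n'. f y * w y \<partial>lborel) / (\<integral>\<^sup>+y\<in>rat_interval n'. w y \<partial>lborel)}" for n
  define E where "E n = (\<Union>i\<in>A n. rat_interval i)" for n
  have fin: "finite (A n)" for n unfolding A_def by simp
  have [measurable]: "E n \<in> sets borel" for n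
    unfolding E_def using fin by (intro sets.finite_UN) auto
  have mono: "E m \<subseteq> E n" if "m \<le> n" for m n using that unfolding E_def A_def by (intro UN_mono) auto
  have level: "{x. l < weighted_maximal w f x} = (\<Union>n. E n)"
  proof (intro set_eqI iffI)
    fix x assume "x \<in> {x. l < weighted_maximal w f x}"
    then obtain n where n: "l < indicator (rat_interval n) x *
       ((\<integral>\<^sup>+y\<in>rat_interval n. f y * w y \<partial>lborel) / (\<integral>\<^sup>+y\<in>rat_interval n. w y \<partial>lborel))"
      unfolding weighted_maximal_def less_SUP_iff mem_Collect_eq by blast
    then have "x \<in> rat_interval n" by (auto split: split_indicator_asm)
    with n have "n \<in> A (Suc n)" unfolding A_def by simp
    with \<open>x \<in> rat_interval n\<close> have "x \<in> E (Suc n)" unfolding E_def by blast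
    then show "x \<in> (\<Union>n. E n)" by blast
  next
    fix x assume "x \<in> (\<Union>n. E n)"
    then obtain i where "x \<in> rat_interval i"
      "l < (\<integral>\<^sup>+y\<in>rat_interval i. f y * w y \<partial>lborel) / (\<integral>\<^sup>+y\<in>rat_interval i. w y \<partial>lborel)"
      unfolding E_def A_def by blast
    then show "x \<in> {x. l < weighted_maximal w f x}"
      using less_le_trans[OF _ weighted_maximal_upper] by blast
  qed
  have fin_bound: "l * (\<integral>\<^sup>+x. w x * indicator (E n) x \<partial>lborel) \<le> 2 * (\<integral>\<^sup>+x. f x * w x \<partial>lborel)" for n
  proof -
    define \<alpha> \<beta> :: "nat \<Rightarrow> real"
      where "\<alpha> i = of_rat (fst (from_nat i :: rat \<times> rat))"
        and "\<beta> i = of_rat (snd (from_nat i :: rat \<times> rat))" for i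
    have ends: "rat_interval i = {\<alpha> i..\<beta> i}" for i
      by (simp add: rat_interval_def \<alpha>_def \<beta>_def case_prod_beta)
    have subcover: "\<exists>G\<subseteq>A n. (\<Union>i\<in>G. rat_interval i) = E n \<and> (\<forall>x. card {i\<in>G. x \<in> rat_interval i} \<le> 2)"
      unfolding E_def ends by (rule interval_subcover[OF fin])
    obtain G where G: "G \<subseteq> A n" "(\<Union>i\<in>G. rat_interval i) = E n"
      and ov: "\<And>x. card {i\<in>G. x \<in> rat_interval i} \<le> 2"
      using subcover by blast
    have G': "finite G" using G fin finite_subset by blast
    have "l * (\<integral>\<^sup>+x. w x * indicator (E n) x \<partial>lborel)
            \<le> l * (\<integral>\<^sup>+x. (\<Sum>i\<in>G. w x * indicator (rat_interval i) x) \<partial>lborel)"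
    proof (intro mult_left_mono nn_integral_mono)
      fix x show "w x * indicator (E n) x \<le> (\<Sum>i\<in>G. w x * indicator (rat_interval i) x)"
      proof (cases "x \<in> E n")
        case True
        then obtain i where i: "i \<in> G" "x \<in> rat_interval i" using G by blast
        show ?thesis using member_le_sum[OF i(1), of "\<lambda>i. w x * indicator (rat_interval i) x"] i(2) G'
          by (simp split: split_indicator)
      qed simp
    qed simp
    also have "\<dots> = (\<Sum>i\<in>G. l * (\<integral>\<^sup>+x\<in>rat_interval i. w x \<partial>lborel))"
      by (subst nn_integral_sum) (auto simp: sum_distrib_left)
    also have "\<dots> \<le> (\<Sum>i\<in>G. (\<integral>\<^sup>+x\<in>rat_interval i. f x * w x \<partial>lborel))"
      using G(1) unfolding A_def by (intro sum_mono ennreal_less_divide_imp) auto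
    also have "\<dots> = (\<integral>\<^sup>+x. (\<Sum>i\<in>G. f x * w x * indicator (rat_interval i) x) \<partial>lborel)"
      by (subst nn_integral_sum) auto
    also have "\<dots> \<le> (\<integral>\<^sup>+x. 2 * (f x * w x) \<partial>lborel)"
    proof (rule nn_integral_mono)
      fix x
      have "(\<Sum>i\<in>G. f x * w x * indicator (rat_interval i) x)
              = f x * w x * of_nat (card {i\<in>G. x \<in> rat_interval i})"
        using G' by (simp add: sum_distrib_left[symmetric] indicator_def sum.If_cases Int_def)
      also have "\<dots> \<le> f x * w x * 2"
        using ov[of x] by (intro mult_left_mono) (metis of_nat_le_iff of_nat_numeral, simp)
      finally show "(\<Sum>i\<in>G. f x * w x * indicator (rat_interval i) x) \<le> 2 * (f x * w x)"
        by (simp add: mult.commute)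
    qed
    finally show ?thesis by (simp add: nn_integral_cmult)
  qed
  have "(\<integral>\<^sup>+x. w x * indicator (\<Union>n. E n) x \<partial>lborel) = (\<integral>\<^sup>+x. (SUP n. w x * indicator (E n) x) \<partial>lborel)"
  proof (rule nn_integral_cong)
    fix x show "w x * indicator (\<Union>n. E n) x = (SUP n. w x * indicator (E n) x)"
    proof (cases "x \<in> (\<Union>n. E n)")
      case True
      then obtain n where "x \<in> E n" by blast
      with True show ?thesis
        by (intro antisym SUP_least) (auto intro!: SUP_upper2[of n] split: split_indicator)
    qed auto
  qed
  also have "\<dots> = (SUP n. \<integral>\<^sup>+x. w x * indicator (E n) x \<partial>lborel)"
    using mono by (intro nn_integral_monotone_convergence_SUP)
      (auto simp: incseq_def le_fun_def split: split_indicator)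
  finally show ?thesis unfolding level
    by (simp add: SUP_mult_left_ennreal fin_bound SUP_le_iff)
qed

text \<open>
  For infinite \<open>y\<close> the integral diverges, since it dominates its values at all finite heights.
\<close>

lemma ennpowr_layer_cake:
  assumes p: "0 < p"
  shows "(\<integral>\<^sup>+l. ennreal (p * l powr (p - 1)) * indicator {0..} l * indicator {l. ennreal l < y} l \<partial>lborel)
           = ennpowr y p" (is "?L y = _")
proof -
  have finite_height: "?L (ennreal c) = ennreal (c powr p)" if c: "0 \<le> c" for c
  proof -
    have "?L (ennreal c) = (\<integral>\<^sup>+l\<in>{0..c}. ennreal (p * l powr (p - 1)) \<partial>lborel)"
    proof (rule nn_integral_cong_AE)
      show "AE l in lborel. ennreal (p * l powr (p - 1)) * indicator {0..} l * indicator {l. ennreal l < ennreal c} l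
              = ennreal (p * l powr (p - 1)) * indicator {0..c} l"
        using AE_lborel_singleton[of c]
        by eventually_elim (use c in \<open>auto simp: ennreal_less_iff split: split_indicator\<close>)
    qed
    also have "\<dots> = ennreal (p * (c powr (p - 1 + 1) / (p - 1 + 1)))"
      using p c by (intro nn_integral_has_integral_lebesgue' has_integral_mult_right has_integral_powr_from_0) auto
    finally show ?thesis using p by simp
  qed
  show ?thesis
  proof (cases y)
    case (real c) then show ?thesis by (simp add: ennpowr_ennreal finite_height)
  next
    case top
    have "?L top = top"
    proof (rule ccontr)
      assume "?L top \<noteq> top"
      then obtain r where r: "?L top = ennreal r" "0 \<le> r" by (cases "?L top") auto
      define c where "c = (r + 1) powr (1 / p)"
      have "ennreal (r + 1) = ?L (ennreal c)"
        using p r by (subst finite_height) (auto simp: c_def powr_powr)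
      also have "\<dots> \<le> ?L top"
        by (intro nn_integral_mono mult_left_mono) (auto split: split_indicator)
      finally show False using r by simp
    qed
    then show ?thesis using top by simp
  qed
qed

text \<open>
  Where \<open>M\<^sub>w f\<close> exceeds \<open>2 l\<close>, the maximal function of the part of \<open>f\<close> above height \<open>l\<close> exceeds
  \<open>l\<close>. Integrating the weak type bound for that part against the layer cake density in \<open>l\<close>
  and exchanging the integrals gives the strong bound.
\<close>

lemma weighted_maximal_strong_type:
  fixes p :: real
  assumes p: "1 < p" and [measurable]: "f \<in> borel_measurable borel" "w \<in> borel_measurable borel"
  shows "(\<integral>\<^sup>+x. ennpowr (weighted_maximal w f x) p * w x \<partial>lborel)
           \<le> ennreal (2 powr p * (2 * p / (p - 1))) * (\<integral>\<^sup>+x. ennpowr (f x) p * w x \<partial>lborel)"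
proof -
  let ?M = "weighted_maximal w"
  let ?c = "\<lambda>l::real. ennreal (p * l powr (p - 1)) * indicator {0..} l"
  let ?d = "\<lambda>l::real. ennreal ((p - 1) * l powr (p - 1 - 1)) * indicator {0..} l"
  have half: "ennpowr y p = ennreal (2 powr p) * ennpowr (y / 2) p" for y
  proof -
    have "y = 2 * (y / 2)" by (simp add: ennreal_times_divide mult_divide_eq_ennreal mult.commute[of 2])
    then have "ennpowr y p = ennpowr (ennreal 2) p * ennpowr (y / 2) p"
      using p by (metis ennpowr_mult ennreal_numeral less_trans zero_less_one zero_le_numeral)
    then show ?thesis by (subst (asm) ennpowr_ennreal) auto
  qed
  have level: "(\<integral>\<^sup>+x. w x * indicator {x. ennreal l < ?M f x / 2} x \<partial>lborel) * ?c l
       \<le> ennreal (2 * p / (p - 1)) * (?d l * (\<integral>\<^sup>+x. f x * indicator {x. ennreal l < f x} x * w x \<partial>lborel))"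
    if l: "0 \<le> l" for l :: real
  proof -
    let ?g = "\<lambda>x. f x * indicator {x. ennreal l < f x} x"
    have "{x. ennreal l < ?M f x / 2} \<subseteq> {x. ennreal l < ?M ?g x}"
    proof clarify
      fix x assume x: "ennreal l < ?M f x / 2"
      have "ennreal l * 2 \<le> ?M f x" using ennreal_less_divide_imp[OF x] .
      moreover have "ennreal l * 2 \<noteq> ?M f x"
      proof
        assume "ennreal l * 2 = ?M f x"
        then have "?M f x / 2 = ennreal l"
          using ennreal_mult_divide_eq[of 2 "ennreal l"] by simp
        then show False using x by simp
      qed
      ultimately have "ennreal l + ennreal l < ?M f x" by (simp add: mult_2_right)
      also have "\<dots> \<le> ?M ?g x + ennreal l" by (rule weighted_maximal_split) measurable
      finally show "ennreal l < ?M ?g x" by (metis add_right_mono not_less)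
    qed
    then have "ennreal l * (\<integral>\<^sup>+x. w x * indicator {x. ennreal l < ?M f x / 2} x \<partial>lborel)
        \<le> ennreal l * (\<integral>\<^sup>+x. w x * indicator {x. ennreal l < ?M ?g x} x \<partial>lborel)"
      by (intro mult_left_mono nn_integral_mono) (auto split: split_indicator)
    also have "\<dots> \<le> 2 * (\<integral>\<^sup>+x. ?g x * w x \<partial>lborel)"
      by (rule weighted_maximal_weak_type) measurable
    finally have weak: "ennreal l * (\<integral>\<^sup>+x. w x * indicator {x. ennreal l < ?M f x / 2} x \<partial>lborel)
        \<le> 2 * (\<integral>\<^sup>+x. ?g x * w x \<partial>lborel)" .
    have c: "?c l = ennreal (p / (p - 1)) * (?d l * ennreal l)"
    proof (cases "l = 0")
      case False
      then have "p * l powr (p - 1) = p / (p - 1) * ((p - 1) * l powr (p - 1 - 1) * l)"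
        using l p by (simp add: powr_diff field_simps power2_eq_square)
      then show ?thesis using l p by (simp flip: ennreal_mult)
    qed (use p in simp)
    have 2: "ennreal (2 * p / (p - 1)) = 2 * ennreal (p / (p - 1))"
      using p by (simp flip: ennreal_numeral ennreal_mult)
    show ?thesis unfolding c 2 using mult_left_mono[OF weak, of "ennreal (p / (p - 1)) * ?d l"]
      by (simp add: ac_simps)
  qed
  have "(\<integral>\<^sup>+x. ennpowr (?M f x / 2) p * w x \<partial>lborel)
      = (\<integral>\<^sup>+x. \<integral>\<^sup>+l. ?c l * indicator {l. ennreal l < ?M f x / 2} l * w x \<partial>lborel \<partial>lborel)"
    using p by (subst nn_integral_multc) (auto simp: ennpowr_layer_cake)
  also have "\<dots> = (\<integral>\<^sup>+l. \<integral>\<^sup>+x. ?c l * indicator {l. ennreal l < ?M f x / 2} l * w x \<partial>lborel \<partial>lborel)"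
    by (rule lborel_pair.Fubini'[symmetric]) measurable
  also have "\<dots> = (\<integral>\<^sup>+l. (\<integral>\<^sup>+x. w x * indicator {x. ennreal l < ?M f x / 2} x \<partial>lborel) * ?c l \<partial>lborel)"
    by (intro nn_integral_cong, subst nn_integral_multc[symmetric])
       (auto intro!: nn_integral_cong split: split_indicator simp: mult.commute)
  also have "\<dots> \<le> (\<integral>\<^sup>+l. ennreal (2 * p / (p - 1)) * (?d l * (\<integral>\<^sup>+x. f x * indicator {x. ennreal l < f x} x * w x \<partial>lborel)) \<partial>lborel)"
  proof (rule nn_integral_mono)
    fix l :: real
    show "(\<integral>\<^sup>+x. w x * indicator {x. ennreal l < ?M f x / 2} x \<partial>lborel) * ?c l
      \<le> ennreal (2 * p / (p - 1)) * (?d l * (\<integral>\<^sup>+x. f x * indicator {x. ennreal l < f x} x * w x \<partial>lborel))"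
      using level[of l] by (cases "0 \<le> l") auto
  qed
  also have "\<dots> = ennreal (2 * p / (p - 1)) * (\<integral>\<^sup>+l. \<integral>\<^sup>+x. f x * w x * (?d l * indicator {l. ennreal l < f x} l) \<partial>lborel \<partial>lborel)"
    by (subst nn_integral_cmult[symmetric], measurable)
       (auto intro!: nn_integral_cong simp: nn_integral_cmult[symmetric] ac_simps split: split_indicator)
  also have "(\<integral>\<^sup>+l. \<integral>\<^sup>+x. f x * w x * (?d l * indicator {l. ennreal l < f x} l) \<partial>lborel \<partial>lborel)
     = (\<integral>\<^sup>+x. \<integral>\<^sup>+l. f x * w x * (?d l * indicator {l. ennreal l < f x} l) \<partial>lborel \<partial>lborel)"
    by (rule lborel_pair.Fubini') measurable
  also have "\<dots> = (\<integral>\<^sup>+x. ennpowr (f x) p * w x \<partial>lborel)"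
  proof (rule nn_integral_cong)
    fix x
    have "(\<integral>\<^sup>+l. f x * w x * (?d l * indicator {l. ennreal l < f x} l) \<partial>lborel) = f x * w x * ennpowr (f x) (p - 1)"
      using p by (subst nn_integral_cmult) (auto simp flip: ennpowr_layer_cake)
    also have "\<dots> = ennpowr (f x) (1 + (p - 1)) * w x"
      unfolding ennpowr_add by (simp add: ac_simps)
    finally show "(\<integral>\<^sup>+l. f x * w x * (?d l * indicator {l. ennreal l < f x} l) \<partial>lborel) = ennpowr (f x) p * w x"
      by simp
  qed
  finally have "ennreal (2 powr p) * (\<integral>\<^sup>+x. ennpowr (?M f x / 2) p * w x \<partial>lborel)
      \<le> ennreal (2 powr p) * (ennreal (2 * p / (p - 1)) * (\<integral>\<^sup>+x. ennpowr (f x) p * w x \<partial>lborel))"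
    by (rule mult_left_mono) simp
  moreover have "(\<integral>\<^sup>+x. ennpowr (?M f x) p * w x \<partial>lborel)
      = ennreal (2 powr p) * (\<integral>\<^sup>+x. ennpowr (?M f x / 2) p * w x \<partial>lborel)"
    unfolding mult.assoc by (subst half, subst nn_integral_cmult[symmetric]) (auto simp: mult.assoc)
  ultimately show ?thesis using p by (subst ennreal_mult) (auto simp: mult.assoc)
qed

lemma weighted_maximal_suminf:
  assumes [measurable]: "\<And>k. F k \<in> borel_measurable borel" "w \<in> borel_measurable borel"
  shows "weighted_maximal w (\<lambda>y. \<Sum>k. ennreal (c k) * F k y) x
           \<le> (\<Sum>k. ennreal (c k) * weighted_maximal w (F k) x)"
proof (rule weighted_maximal_least)
  fix n assume x: "x \<in> rat_interval n"
  let ?J = "rat_interval n"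
  have "(\<integral>\<^sup>+y\<in>?J. (\<Sum>k. ennreal (c k) * F k y) * w y \<partial>lborel)
      = (\<integral>\<^sup>+y. (\<Sum>k. ennreal (c k) * (F k y * w y * indicator ?J y)) \<partial>lborel)"
    by (intro nn_integral_cong) (simp only: ennreal_suminf_multc flip: mult.assoc)
  also have "\<dots> = (\<Sum>k. ennreal (c k) * (\<integral>\<^sup>+y\<in>?J. F k y * w y \<partial>lborel))"
    by (subst nn_integral_suminf) (auto simp: nn_integral_cmult)
  finally show "(\<integral>\<^sup>+y\<in>?J. (\<Sum>k. ennreal (c k) * F k y) * w y \<partial>lborel) / (\<integral>\<^sup>+y\<in>?J. w y \<partial>lborel)
      \<le> (\<Sum>k. ennreal (c k) * weighted_maximal w (F k) x)"
    using weighted_maximal_upper[OF x]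
    by (simp add: divide_ennreal_def flip: ennreal_suminf_multc)
       (auto intro!: suminf_le mult_left_mono simp: mult.assoc)
qed

text \<open>
  The Rubio de Francia iteration: \<open>s\<close> is the sum of \<open>a\<^sup>k M\<^sub>w\<^sup>k h\<close>. Applying \<open>M\<^sub>w\<close> shifts the
  series, so \<open>M\<^sub>w s \<le> s / a\<close>, while a small \<open>a\<close> compensates the growth of the norms of the
  iterates.
\<close>

lemma maximal_majorant:
  fixes p :: real
  assumes p: "1 < p"
  shows "\<exists>K>0. \<forall>w\<in>borel_measurable borel. \<forall>h\<in>borel_measurable borel.
    \<exists>s\<in>borel_measurable borel. (\<forall>x. h x \<le> s x) \<and>
      (\<forall>x. weighted_maximal w s x \<le> ennreal K * s x) \<and>
      (\<integral>\<^sup>+x. ennpowr (s x) p * w x \<partial>lborel) \<le> ennreal K * (\<integral>\<^sup>+x. ennpowr (h x) p * w x \<partial>lborel)"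
proof -
  define C where "C = 2 powr p * (2 * p / (p - 1))"
  define A where "A = max 1 (C powr (1 / p))"
  define a where "a = 1 / (4 * A)"
  have C: "0 < C" and A: "1 \<le> A" and a: "0 < a" using p by (auto simp: C_def A_def a_def)
  have CA: "C \<le> A powr p"
  proof -
    have "C = (C powr (1 / p)) powr p" using p C by (simp add: powr_powr)
    also have "\<dots> \<le> A powr p" using p by (intro powr_mono2) (auto simp: A_def)
    finally show ?thesis .
  qed
  \<comment> \<open>with a = 1/(4A), one factor 1/2 per step makes the series for s summable and the other one
    makes the sum of the weighted norms of its terms converge\<close>
  have ratio: "(2 * a) powr p * C \<le> 1 / 2"
  proof -
    have "(2 * a) powr p * C \<le> (2 * a) powr p * A powr p" using CA by (intro mult_left_mono) auto
    also have "\<dots> = (1 / 2) powr p" using A a by (subst powr_mult[symmetric]) (auto simp: a_def)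
    also have "\<dots> \<le> (1 / 2) powr 1" using p by (intro powr_mono') auto
    finally show ?thesis by simp
  qed
  have half_sum: "(\<Sum>k. ennreal ((1 / 2) ^ k)) = ennreal 2"
    using geometric_sums[of "1 / 2 :: real"] by (intro suminf_ennreal_eq) auto
  define K where "K = max (4 * A) (2 powr p * 2)"
  have "\<exists>s\<in>borel_measurable borel. (\<forall>x. h x \<le> s x) \<and>
      (\<forall>x. weighted_maximal w s x \<le> ennreal K * s x) \<and>
      (\<integral>\<^sup>+x. ennpowr (s x) p * w x \<partial>lborel) \<le> ennreal K * (\<integral>\<^sup>+x. ennpowr (h x) p * w x \<partial>lborel)"
    if [measurable]: "w \<in> borel_measurable borel" "h \<in> borel_measurable borel" for w h
  proof -
    define T where "T k = (weighted_maximal w ^^ k) h" for k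
    define s where "s x = (\<Sum>k. ennreal (a ^ k) * T k x)" for x
    let ?I = "\<integral>\<^sup>+x. ennpowr (h x) p * w x \<partial>lborel"
    have [measurable]: "T k \<in> borel_measurable borel" for k
      by (cases k) (auto simp: T_def)
    have [measurable]: "s \<in> borel_measurable borel" unfolding s_def by measurable
    have TSuc: "weighted_maximal w (T k) = T (Suc k)" for k by (simp add: T_def)
    have T_int: "(\<integral>\<^sup>+x. ennpowr (T k x) p * w x \<partial>lborel) \<le> ennreal (C ^ k) * ?I" for k
    proof (induction k)
      case (Suc k)
      have "(\<integral>\<^sup>+x. ennpowr (T (Suc k) x) p * w x \<partial>lborel) \<le> ennreal C * (\<integral>\<^sup>+x. ennpowr (T k x) p * w x \<partial>lborel)"
        unfolding TSuc[symmetric] C_def by (rule weighted_maximal_strong_type) (use p in auto)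
      also have "\<dots> \<le> ennreal C * (ennreal (C ^ k) * ?I)" by (intro mult_left_mono Suc) auto
      finally show ?case using C by (simp add: ennreal_mult mult.assoc)
    qed (simp add: T_def)
    have 1: "h x \<le> s x" for x
      using sum_le_suminf[of "\<lambda>k. ennreal (a ^ k) * T k x" "{0}"] by (simp add: s_def T_def)
    have 2: "weighted_maximal w s x \<le> ennreal K * s x" for x
    proof -
      have "weighted_maximal w s x \<le> (\<Sum>k. ennreal (a ^ k) * T (Suc k) x)"
        unfolding s_def TSuc[symmetric] by (rule weighted_maximal_suminf) auto
      also have "\<dots> = (\<Sum>k. ennreal (4 * A) * (ennreal (a ^ Suc k) * T (Suc k) x))"
        using a A by (intro suminf_cong) (simp add: mult.assoc[symmetric] a_def flip: ennreal_mult)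
      also have "\<dots> = ennreal (4 * A) * (\<Sum>k. ennreal (a ^ Suc k) * T (Suc k) x)"
        by (rule ennreal_suminf_cmult)
      also have "\<dots> \<le> ennreal (4 * A) * s x"
        unfolding s_def using suminf_offset[of "\<lambda>k. ennreal (a ^ k) * T k x" 1]
        by (intro mult_left_mono) (auto simp: le_iff_add add.commute)
      also have "\<dots> \<le> ennreal K * s x" by (intro mult_right_mono ennreal_leI) (auto simp: K_def)
      finally show ?thesis .
    qed
    have 3: "(\<integral>\<^sup>+x. ennpowr (s x) p * w x \<partial>lborel) \<le> ennreal K * ?I"
    proof -
      define b where "b k x = ennreal ((2 * a) ^ k) * T k x" for k x
      have [measurable]: "b k \<in> borel_measurable borel" for k unfolding b_def by measurable
      \<comment> \<open>bounding the series by a supremum avoids the triangle inequality in the weighted norm\<close>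
      have s_sup: "s x \<le> (SUP k. b k x) * ennreal 2" for x
      proof -
        have "s x = (\<Sum>k. b k x * ennreal ((1 / 2) ^ k))"
          unfolding s_def
        proof (rule suminf_cong)
          fix k
          have "a ^ k = (2 * a) ^ k * (1 / 2) ^ k"
            by (subst power_mult_distrib[symmetric]) simp
          then have "ennreal (a ^ k) = ennreal ((2 * a) ^ k) * ennreal ((1 / 2) ^ k)"
            using a by (metis ennreal_mult mult_pos_pos zero_less_numeral zero_le_power less_imp_le zero_le_divide_1_iff zero_le_numeral)
          then show "ennreal (a ^ k) * T k x = b k x * ennreal ((1 / 2) ^ k)"
            by (simp only: b_def ac_simps)
        qed
        also have "\<dots> \<le> (\<Sum>k. (SUP k. b k x) * ennreal ((1 / 2) ^ k))"
          by (intro suminf_le mult_right_mono SUP_upper) auto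
        also have "\<dots> = (SUP k. b k x) * ennreal 2" by (simp only: ennreal_suminf_cmult half_sum)
        finally show ?thesis .
      qed
      have "ennpowr (s x) p \<le> ennreal (2 powr p) * (\<Sum>k. ennpowr (b k x) p)" for x
      proof -
        have "ennpowr (s x) p \<le> ennpowr ((SUP k. b k x) * ennreal 2) p"
          using p s_sup by (intro ennpowr_mono) auto
        also have "\<dots> = (SUP k. ennpowr (b k x) p) * ennreal (2 powr p)"
          using p by (simp add: ennpowr_mult ennpowr_SUP ennpowr_ennreal del: ennreal_numeral)
        also have "\<dots> \<le> (\<Sum>k. ennpowr (b k x) p) * ennreal (2 powr p)"
        proof (intro mult_right_mono SUP_least)
          fix k show "ennpowr (b k x) p \<le> (\<Sum>k. ennpowr (b k x) p)"
            by (rule ennreal_le_suminf)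
        qed simp
        finally show ?thesis by (simp add: mult.commute)
      qed
      then have "(\<integral>\<^sup>+x. ennpowr (s x) p * w x \<partial>lborel)
          \<le> (\<integral>\<^sup>+x. ennreal (2 powr p) * (\<Sum>k. ennpowr (b k x) p * w x) \<partial>lborel)"
        by (intro nn_integral_mono) (auto simp: ennreal_suminf_multc mult.assoc[symmetric] intro: mult_right_mono)
      also have "\<dots> = ennreal (2 powr p) * (\<Sum>k. \<integral>\<^sup>+x. ennpowr (b k x) p * w x \<partial>lborel)"
        by (subst nn_integral_cmult, measurable) (subst nn_integral_suminf, auto)
      also have "\<dots> \<le> ennreal (2 powr p) * (\<Sum>k. ennreal ((1 / 2) ^ k) * ?I)"
      proof (intro mult_left_mono suminf_le)
        fix k
        have "((2 * a) ^ k) powr p = ((2 * a) powr p) ^ k"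
          using a by (induction k) (auto simp: powr_mult)
        then have b_k: "ennpowr (b k x) p = ennreal (((2 * a) powr p) ^ k) * ennpowr (T k x) p" for x
          using p a by (simp add: b_def ennpowr_mult ennpowr_ennreal)
        have "(\<integral>\<^sup>+x. ennpowr (b k x) p * w x \<partial>lborel)
            = ennreal (((2 * a) powr p) ^ k) * (\<integral>\<^sup>+x. ennpowr (T k x) p * w x \<partial>lborel)"
          unfolding b_k mult.assoc by (rule nn_integral_cmult) measurable
        also have "\<dots> \<le> ennreal (((2 * a) powr p) ^ k) * (ennreal (C ^ k) * ?I)"
          by (intro mult_left_mono T_int) auto
        also have "\<dots> = ennreal (((2 * a) powr p * C) ^ k) * ?I"
          using C by (simp add: power_mult_distrib ennreal_mult mult.assoc)
        also have "\<dots> \<le> ennreal ((1 / 2) ^ k) * ?I"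
          using ratio C by (intro mult_right_mono ennreal_leI power_mono) auto
        finally show "(\<integral>\<^sup>+x. ennpowr (b k x) p * w x \<partial>lborel) \<le> ennreal ((1 / 2) ^ k) * ?I" .
      qed auto
      also have "\<dots> = ennreal (2 powr p) * (ennreal 2 * ?I)"
        by (simp only: ennreal_suminf_multc half_sum)
      also have "\<dots> = ennreal (2 powr p * 2) * ?I"
        by (simp add: ennreal_mult mult.assoc del: ennreal_numeral)
      also have "\<dots> \<le> ennreal K * ?I" by (intro mult_right_mono ennreal_leI) (auto simp: K_def)
      finally show ?thesis .
    qed
    show ?thesis using 1 2 3 by (intro bexI[of _ s]) auto
  qed
  moreover have "0 < K" using A by (auto simp: K_def)
  ultimately show ?thesis by blast
qed

section \<open>Changing the weight\<close>

text \<open>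
  An infinite average over an interval forces \<open>M\<^sub>w s\<close>, and hence \<open>s\<close>, to be infinite at every
  point of that interval, which contradicts the integrability of the power of \<open>s\<close>.
\<close>

lemma weighted_average_less_top:
  assumes [measurable]: "s \<in> borel_measurable borel" "w \<in> borel_measurable borel"
    and s: "\<And>x. weighted_maximal w s x \<le> ennreal K * s x"
    and fin: "(\<integral>\<^sup>+x. ennpowr (s x) p * w x \<partial>lborel) < top"
    and B: "(\<integral>\<^sup>+y\<in>rat_interval n. w y \<partial>lborel) \<noteq> 0" "(\<integral>\<^sup>+y\<in>rat_interval n. w y \<partial>lborel) \<noteq> top"
  shows "(\<integral>\<^sup>+y\<in>rat_interval n. s y * w y \<partial>lborel) < top"
proof (rule ccontr)
  let ?J = "rat_interval n"
  assume "\<not> (\<integral>\<^sup>+y\<in>?J. s y * w y \<partial>lborel) < top"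
  then have "(\<integral>\<^sup>+y\<in>?J. s y * w y \<partial>lborel) = top" by (metis top.not_eq_extremum)
  then have "s x = top" if "x \<in> ?J" for x
    using order_trans[OF weighted_maximal_upper[OF that, of s w] s[of x]] B
    by (auto simp: ennreal_top_divide top_unique ennreal_mult_eq_top_iff)
  then have "(\<integral>\<^sup>+y. top * (w y * indicator ?J y) \<partial>lborel) \<le> (\<integral>\<^sup>+x. ennpowr (s x) p * w x \<partial>lborel)"
    by (intro nn_integral_mono) (auto split: split_indicator)
  also have "(\<integral>\<^sup>+y. top * (w y * indicator ?J y) \<partial>lborel) = top * (\<integral>\<^sup>+y\<in>?J. w y \<partial>lborel)"
    by (rule nn_integral_cmult) measurable
  finally show False using fin B by (simp add: ennreal_top_mult top_unique)
qed

lemma weighted_average_eq_0: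
  assumes [measurable]: "f \<in> borel_measurable borel" "w \<in> borel_measurable borel" "A \<in> sets borel"
    and "(\<integral>\<^sup>+y\<in>A. w y \<partial>lborel) = 0"
  shows "(\<integral>\<^sup>+y\<in>A. f y * w y \<partial>lborel) = 0"
proof -
  have "AE y in lborel. w y * indicator A y = 0"
    using assms(4) by (subst (asm) nn_integral_0_iff_AE) auto
  then have "AE y in lborel. f y * w y * indicator A y = 0" by eventually_elim auto
  then show ?thesis by (subst nn_integral_0_iff_AE) auto
qed

text \<open>
  Let \<open>B\<close>, \<open>S\<close> and \<open>F\<close> be the integrals of \<open>w\<close>, \<open>s w\<close> and \<open>f w\<close> over an interval. The bound on
  \<open>M\<^sub>w s\<close> says \<open>S / B \<le> K s\<close> at all points of the interval, and \<open>F / B = (S / B) (F / S)\<close>. The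
  factor \<open>S / B\<close> is estimated either under the integral \<open>F\<close>, which gives the first inequality,
  or at the point \<open>x\<close>, which gives the second. The assumption on null intervals makes the
  identity valid when \<open>S = 0\<close>.
\<close>

lemma weighted_maximal_change_weight:
  assumes [measurable]: "f \<in> borel_measurable borel" "s \<in> borel_measurable borel" "w \<in> borel_measurable borel"
    and s: "\<And>x. weighted_maximal w s x \<le> ennreal K * s x"
    and fin: "(\<integral>\<^sup>+x. ennpowr (s x) p * w x \<partial>lborel) < top"
    and null: "\<And>n. (\<integral>\<^sup>+y\<in>rat_interval n. w y \<partial>lborel) \<noteq> 0 \<Longrightarrow>
      (\<integral>\<^sup>+y\<in>rat_interval n. w y \<partial>lborel) \<noteq> top \<Longrightarrow>
      (\<integral>\<^sup>+y\<in>rat_interval n. s y * w y \<partial>lborel) = 0 \<Longrightarrow>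
      (\<integral>\<^sup>+y\<in>rat_interval n. f y * w y \<partial>lborel) = 0"
  shows "weighted_maximal w f x \<le> ennreal K * weighted_maximal (\<lambda>y. s y * w y) f x"
    and "(\<And>y. s y = 0 \<Longrightarrow> f y = 0) \<Longrightarrow>
      weighted_maximal w f x \<le> ennreal K * s x * weighted_maximal (\<lambda>y. s y * w y) (\<lambda>y. f y / s y) x"
proof -
  have "(\<integral>\<^sup>+y\<in>rat_interval n. f y * w y \<partial>lborel) / (\<integral>\<^sup>+y\<in>rat_interval n. w y \<partial>lborel)
      \<le> ennreal K * weighted_maximal (\<lambda>y. s y * w y) f x \<and>
      ((\<forall>y. s y = 0 \<longrightarrow> f y = 0) \<longrightarrow>
      (\<integral>\<^sup>+y\<in>rat_interval n. f y * w y \<partial>lborel) / (\<integral>\<^sup>+y\<in>rat_interval n. w y \<partial>lborel)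
      \<le> ennreal K * s x * weighted_maximal (\<lambda>y. s y * w y) (\<lambda>y. f y / s y) x)"
    if x: "x \<in> rat_interval n" for n
  proof -
    let ?J = "rat_interval n"
    define B F S where "B = (\<integral>\<^sup>+y\<in>?J. w y \<partial>lborel)" and "F = (\<integral>\<^sup>+y\<in>?J. f y * w y \<partial>lborel)"
      and "S = (\<integral>\<^sup>+y\<in>?J. s y * w y \<partial>lborel)"
    show ?thesis
    proof (cases "B = 0 \<or> B = top \<or> S = 0")
      case True
      then have "F = 0 \<or> B = top"
        using null[of n] weighted_average_eq_0[of f w ?J] by (auto simp: B_def F_def S_def)
      then have "F / B = 0" by auto
      then have "F / B \<le> c" for c by (metis zero_le)
      then show ?thesis unfolding B_def F_def by blast
    next
      case False
      then have "S < top" unfolding B_def S_def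
        using s fin by (intro weighted_average_less_top) auto
      have S: "S \<noteq> 0" "S \<noteq> top" using False \<open>S < top\<close> by auto
      have "F / B = S / S * F / B" using S by (simp add: ennreal_divide_self less_top)
      then have FB: "F / B = (S / B) * F / S" by (simp add: divide_ennreal_def ac_simps)
      have SB: "S / B \<le> ennreal K * s y" if "y \<in> ?J" for y
        unfolding S_def B_def using weighted_maximal_upper[OF that] s by (rule order_trans)
      have "(S / B) * F = (\<integral>\<^sup>+y. (S / B) * (f y * w y * indicator ?J y) \<partial>lborel)"
        unfolding F_def by (subst nn_integral_cmult) auto
      also have "\<dots> \<le> (\<integral>\<^sup>+y. ennreal K * (f y * (s y * w y) * indicator ?J y) \<partial>lborel)"
      proof (rule nn_integral_mono)
        fix y
        show "(S / B) * (f y * w y * indicator ?J y) \<le> ennreal K * (f y * (s y * w y) * indicator ?J y)"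
          using mult_right_mono[OF SB[of y], of "f y * w y"] by (auto simp: ac_simps split: split_indicator)
      qed
      also have "\<dots> = ennreal K * (\<integral>\<^sup>+y\<in>?J. f y * (s y * w y) \<partial>lborel)"
        by (subst nn_integral_cmult) auto
      finally have "F / B \<le> ennreal K * (\<integral>\<^sup>+y\<in>?J. f y * (s y * w y) \<partial>lborel) / S"
        unfolding FB by (rule divide_right_mono_ennreal)
      also have "\<dots> = ennreal K * ((\<integral>\<^sup>+y\<in>?J. f y * (s y * w y) \<partial>lborel) / S)"
        by (simp add: ennreal_times_divide)
      also have "\<dots> \<le> ennreal K * weighted_maximal (\<lambda>y. s y * w y) f x"
        unfolding S_def by (intro mult_left_mono weighted_maximal_upper x) auto
      finally have 1: "F / B \<le> ennreal K * weighted_maximal (\<lambda>y. s y * w y) f x" .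
      have 2: "F / B \<le> ennreal K * s x * weighted_maximal (\<lambda>y. s y * w y) (\<lambda>y. f y / s y) x"
        if f0: "\<forall>y. s y = 0 \<longrightarrow> f y = 0"
      proof -
        have "AE y in lborel. ennpowr (s y) p * w y \<noteq> \<infinity>"
          using fin by (intro nn_integral_PInf_AE) auto
        then have "AE y in lborel. f y * w y * indicator ?J y = f y / s y * (s y * w y) * indicator ?J y"
        proof eventually_elim
          case (elim y)
          show ?case
          proof (cases "s y = 0 \<or> s y = top")
            case True
            then show ?thesis using elim f0 by (auto simp: ennreal_top_mult split: if_splits)
          next
            case False
            then have "f y / s y * s y = f y"
              by (simp add: ennreal_divide_times ennreal_divide_self less_top)
            then show ?thesis by (metis mult.assoc)
          qed
        qed
        then have "F = (\<integral>\<^sup>+y\<in>?J. f y / s y * (s y * w y) \<partial>lborel)"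
          unfolding F_def by (rule nn_integral_cong_AE)
        then have "F / S \<le> weighted_maximal (\<lambda>y. s y * w y) (\<lambda>y. f y / s y) x"
          unfolding S_def using weighted_maximal_upper[OF x] by simp
        then have "S / B * (F / S) \<le> ennreal K * s x * weighted_maximal (\<lambda>y. s y * w y) (\<lambda>y. f y / s y) x"
          by (intro mult_mono SB x) auto
        then show ?thesis unfolding FB by (simp add: ennreal_times_divide)
      qed
      show ?thesis using 1 2 unfolding F_def B_def by blast
    qed
  qed
  then show "weighted_maximal w f x \<le> ennreal K * weighted_maximal (\<lambda>y. s y * w y) f x"
    "(\<And>y. s y = 0 \<Longrightarrow> f y = 0) \<Longrightarrow>
      weighted_maximal w f x \<le> ennreal K * s x * weighted_maximal (\<lambda>y. s y * w y) (\<lambda>y. f y / s y) x"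
    by (blast intro: weighted_maximal_least)+
qed

section \<open>Sequence-valued bounds on the line\<close>

text \<open>
  Compare \<open>y\<close> with \<open>s\<close> to the power \<open>1 / \<theta> - 1\<close>. Below this threshold the first term dominates.
  Above it, the surplus \<open>s\<close> to the power \<open>r - 1\<close> is absorbed by \<open>y\<close> to the power \<open>u - r\<close>. The
  value of \<open>\<theta>\<close> makes the two exponents match. A dichotomy of this kind replaces the inequality
  of Hoelder.
\<close>

lemma ennpowr_product_split:
  assumes r: "1 < r" "r < u" and th: "\<theta> = (u - r) / (u - 1)"
  shows "ennpowr (s * y) r \<le> ennpowr s (r / \<theta>) + s * ennpowr y u"
proof (cases "s = 0 \<or> y = 0 \<or> s = top \<or> y = top")
  case True then show ?thesis using r by (auto simp: ennreal_mult_top ennreal_top_mult)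
next
  case False
  then obtain a b where ab: "s = ennreal a" "y = ennreal b" "0 < a" "0 < b"
    by (cases s; cases y) (auto simp: less_le)
  have "(a * b) powr r \<le> a powr (r / \<theta>) + a * b powr u"
  proof (cases "a * b \<le> a powr (1 / \<theta>)")
    case True
    then have "(a * b) powr r \<le> (a powr (1 / \<theta>)) powr r" using r ab by (intro powr_mono2) auto
    also have "\<dots> = a powr (r / \<theta>)" by (simp add: powr_powr)
    finally show ?thesis using ab by (simp add: add_increasing2)
  next
    case False
    then have "a powr (1 / \<theta>) / a \<le> b" using ab by (simp add: field_simps)
    then have "a powr (1 / \<theta> - 1) \<le> b" using ab by (simp add: powr_diff)
    then have "(a powr (1 / \<theta> - 1)) powr (u - r) \<le> b powr (u - r)"
      using r by (intro powr_mono2) auto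
    moreover have "(1 / \<theta> - 1) * (u - r) = r - 1" using r by (simp add: th field_simps)
    ultimately have *: "a powr (r - 1) \<le> b powr (u - r)" by (simp add: powr_powr)
    have "(a * b) powr r = a * (a powr (r - 1) * b powr r)"
      using ab by (simp add: powr_mult powr_diff)
    also have "\<dots> \<le> a * (b powr (u - r) * b powr r)"
      using * ab by (intro mult_left_mono mult_right_mono) auto
    also have "\<dots> = a * b powr u" by (simp flip: powr_add)
    finally show ?thesis using powr_ge_zero[of a "r / \<theta>"] by linarith
  qed
  then show ?thesis using ab
    by (simp add: ennpowr_ennreal ennreal_leI flip: ennreal_mult ennreal_plus)
qed

text \<open>
  The negative power \<open>1 - u\<close> of \<open>s\<close> is at most that of \<open>h\<close> to the power \<open>\<theta>\<close>, and
  \<open>u + \<theta> (1 - u) = r\<close>.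
\<close>

lemma ennpowr_quotient_bound:
  assumes r: "1 < r" "r < u" and th: "\<theta> = (u - r) / (u - 1)" and hs: "ennpowr h \<theta> \<le> s"
  shows "ennpowr (h / s) u * s \<le> ennpowr h r"
proof (cases "h = 0 \<or> h = top \<or> s = top")
  case True then show ?thesis using r by (auto simp: ennreal_mult_top ennreal_top_mult)
next
  case False
  then obtain a b where ab: "h = ennreal a" "s = ennreal b" "0 < a" "0 \<le> b"
    by (cases s; cases h) (auto simp: less_le)
  have le: "a powr \<theta> \<le> b" using hs ab by (simp add: ennpowr_ennreal)
  have b: "0 < b" by (rule less_le_trans[OF _ le]) (use ab in simp)
  have "(a / b) powr u * b = a powr u * b powr (1 - u)"
    using ab b by (simp add: powr_divide powr_diff)
  also have "\<dots> \<le> a powr u * (a powr \<theta>) powr (1 - u)"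
    using le r ab b by (intro mult_left_mono powr_mono2') auto
  also have "\<dots> = a powr (u + \<theta> * (1 - u))" by (simp add: powr_powr powr_add)
  also have "u + \<theta> * (1 - u) = r" using r by (simp add: th field_simps)
  finally show ?thesis using ab b
    by (simp add: ennpowr_ennreal ennreal_leI divide_ennreal flip: ennreal_mult)
qed

text \<open>
  A dichotomy according to whether \<open>s\<close> exceeds \<open>B h\<close> to the power \<open>r - u\<close>. The parameter \<open>B\<close>
  makes the first coefficient as small as desired.
\<close>

lemma ennpowr_absorb:
  assumes r: "0 < u" "u < r" and B: "0 < B"
  shows "ennpowr h u * s \<le> ennreal (B powr (- u)) * ennpowr s (r / (r - u))
                           + ennreal (B powr (r - u)) * ennpowr h r"
proof (cases "h = 0 \<or> s = 0 \<or> h = top \<or> s = top")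
  case True then show ?thesis using r B by (auto simp: ennreal_mult_top)
next
  case False
  then obtain a b where ab: "h = ennreal a" "s = ennreal b" "0 < a" "0 < b"
    by (cases s; cases h) (auto simp: less_le)
  have "a powr u * b \<le> B powr (- u) * b powr (r / (r - u)) + B powr (r - u) * a powr r"
  proof (cases "b \<le> (B * a) powr (r - u)")
    case True
    then have "a powr u * b \<le> a powr u * (B * a) powr (r - u)" using ab by (intro mult_left_mono) auto
    also have "\<dots> = B powr (r - u) * a powr r"
      using ab B by (simp add: powr_mult powr_diff)
    finally show ?thesis using B by (simp add: add_increasing)
  next
    case False
    then have "((B * a) powr (r - u)) powr (u / (r - u)) \<le> b powr (u / (r - u))"
      using r by (intro powr_mono2) auto
    then have "B powr u * a powr u \<le> b powr (u / (r - u))" using r ab B by (simp add: powr_powr powr_mult)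
    then have "a powr u \<le> B powr (- u) * b powr (u / (r - u))"
      using B by (simp add: powr_minus field_simps)
    then have "a powr u * b \<le> B powr (- u) * b powr (u / (r - u)) * b"
      using ab by (intro mult_right_mono) auto
    also have "\<dots> = B powr (- u) * b powr (u / (r - u) + 1)" using ab by (simp add: powr_add)
    also have "u / (r - u) + 1 = r / (r - u)" using r by (simp add: field_simps)
    finally show ?thesis by (simp add: add_increasing2)
  qed
  then show ?thesis using ab
    by (simp add: ennpowr_ennreal ennreal_leI flip: ennreal_mult ennreal_plus)
qed

lemma weighted_maximal_zero [simp]: "weighted_maximal w (\<lambda>_. 0) x = 0"
  by (simp add: weighted_maximal_def)

text \<open>
  For equal exponents the sum over \<open>j\<close> can be taken outside the integral.
\<close>

lemma vector_maximal_diagonal: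
  fixes u :: real
  assumes u: "1 < u" and [measurable]: "\<And>j. g j \<in> borel_measurable borel" "w \<in> borel_measurable borel"
  shows "(\<integral>\<^sup>+x. (\<Sum>j. ennpowr (weighted_maximal w (g j) x) u) * w x \<partial>lborel)
      \<le> ennreal (2 powr u * (2 * u / (u - 1))) * (\<integral>\<^sup>+x. (\<Sum>j. ennpowr (g j x) u) * w x \<partial>lborel)"
proof -
  have sum: "(\<integral>\<^sup>+x. (\<Sum>j. f j x) * w x \<partial>lborel) = (\<Sum>j. \<integral>\<^sup>+x. f j x * w x \<partial>lborel)"
    if [measurable]: "\<And>j. f j \<in> borel_measurable borel" for f :: "nat \<Rightarrow> real \<Rightarrow> ennreal"
    unfolding ennreal_suminf_multc[symmetric] by (rule nn_integral_suminf) measurable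
  have "(\<integral>\<^sup>+x. (\<Sum>j. ennpowr (weighted_maximal w (g j) x) u) * w x \<partial>lborel)
      = (\<Sum>j. \<integral>\<^sup>+x. ennpowr (weighted_maximal w (g j) x) u * w x \<partial>lborel)"
    by (rule sum) measurable
  also have "\<dots> \<le> (\<Sum>j. ennreal (2 powr u * (2 * u / (u - 1))) * (\<integral>\<^sup>+x. ennpowr (g j x) u * w x \<partial>lborel))"
    by (intro suminf_le weighted_maximal_strong_type) (use u in auto)
  also have "\<dots> = ennreal (2 powr u * (2 * u / (u - 1))) * (\<integral>\<^sup>+x. (\<Sum>j. ennpowr (g j x) u) * w x \<partial>lborel)"
    by (subst sum, measurable)
  finally show ?thesis .
qed

text \<open>
  Let \<open>h\<close> be the \<open>l\<^sup>u\<close> norm of the sequence \<open>g\<close>, and let \<open>s\<close> be a majorant of \<open>h\<close> to the power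
  \<open>\<theta>\<close> with \<open>M\<^sub>w s \<le> K s\<close>. Then \<open>M\<^sub>w g\<^sub>j \<le> K s Y\<^sub>j\<close> where \<open>Y\<^sub>j\<close> is the maximal function of \<open>g\<^sub>j / s\<close> for
  the measure \<open>v dx = s w dx\<close>, so the bound for equal exponents applies to \<open>Y\<close> and \<open>v\<close>. The
  exponent \<open>\<theta>\<close> is the one for which both terms of \<open>ennpowr_product_split\<close> return to the
  integral of \<open>h\<close> to the power \<open>r\<close>.
\<close>

lemma vector_maximal_below:
  fixes u r :: real
  assumes r: "1 < r" "r < u"
  shows "\<exists>C>0. \<forall>w\<in>borel_measurable borel. \<forall>g. (\<forall>j. g j \<in> borel_measurable borel) \<longrightarrow>
    (\<integral>\<^sup>+x. ennpowr (ell_norm (ennreal u) (\<lambda>j. weighted_maximal w (g j) x)) r * w x \<partial>lborel)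
      \<le> ennreal C * (\<integral>\<^sup>+x. ennpowr (ell_norm (ennreal u) (\<lambda>j. g j x)) r * w x \<partial>lborel)"
proof -
  define \<theta> where "\<theta> = (u - r) / (u - 1)"
  have \<theta>: "0 < \<theta>" "\<theta> < 1" using r by (auto simp: \<theta>_def field_simps)
  define p where "p = r / \<theta>"
  have p: "1 < p" using r \<theta> by (simp add: p_def field_simps)
  obtain K where K: "0 < K" and maj: "\<forall>w\<in>borel_measurable borel. \<forall>h\<in>borel_measurable borel. \<exists>s\<in>borel_measurable borel. (\<forall>x. h x \<le> s x) \<and>
      (\<forall>x. weighted_maximal w s x \<le> ennreal K * s x) \<and>
      (\<integral>\<^sup>+x. ennpowr (s x) p * w x \<partial>lborel) \<le> ennreal K * (\<integral>\<^sup>+x. ennpowr (h x) p * w x \<partial>lborel)"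
    using maximal_majorant[OF p] by blast
  define D where "D = 2 powr u * (2 * u / (u - 1))"
  have D: "0 < D" using r by (simp add: D_def)
  define C where "C = K powr r * (K + D)"
  have C: "0 < C" using K D by (simp add: C_def)
  have u0: "0 < ennreal u" "0 < u" using r by auto
  have "(\<integral>\<^sup>+x. ennpowr (ell_norm (ennreal u) (\<lambda>j. weighted_maximal w (g j) x)) r * w x \<partial>lborel)
      \<le> ennreal C * (\<integral>\<^sup>+x. ennpowr (ell_norm (ennreal u) (\<lambda>j. g j x)) r * w x \<partial>lborel)" (is "?L \<le> _ * ?R")
    if [measurable]: "w \<in> borel_measurable borel" "\<And>j. g j \<in> borel_measurable borel" for w g
  proof (cases "?R = top")
    case True then show ?thesis using C by (simp add: ennreal_mult_top)
  next
    case False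
    define h where "h x = ell_norm (ennreal u) (\<lambda>j. g j x)" for x
    have [measurable]: "h \<in> borel_measurable borel" unfolding h_def by measurable
    obtain s where [measurable]: "s \<in> borel_measurable borel" and hs: "\<And>x. ennpowr (h x) \<theta> \<le> s x"
      and A1: "\<And>x. weighted_maximal w s x \<le> ennreal K * s x"
      and int: "(\<integral>\<^sup>+x. ennpowr (s x) p * w x \<partial>lborel) \<le> ennreal K * (\<integral>\<^sup>+x. ennpowr (ennpowr (h x) \<theta>) p * w x \<partial>lborel)"
      using maj[rule_format, of w "\<lambda>x. ennpowr (h x) \<theta>"] by auto
    have "\<theta> * p = r" using \<theta> by (simp add: p_def)
    then have int: "(\<integral>\<^sup>+x. ennpowr (s x) p * w x \<partial>lborel) \<le> ennreal K * ?R"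
      using int by (simp add: ennpowr_ennpowr h_def)
    then have fin: "(\<integral>\<^sup>+x. ennpowr (s x) p * w x \<partial>lborel) < top"
      using False by (auto simp: less_top[symmetric] top_unique ennreal_mult_eq_top_iff)
    have gh: "g j x \<le> h x" for j x unfolding h_def by (rule ell_norm_upper) (use r in simp)
    have g0: "g j x = 0" if "s x = 0" for j x
      using gh[of j x] hs[of x] that by simp
    define v where "v x = s x * w x" for x
    have [measurable]: "v \<in> borel_measurable borel" unfolding v_def by measurable
    define Y where "Y j x = weighted_maximal v (\<lambda>y. g j y / s y) x" for j x
    have [measurable]: "Y j \<in> borel_measurable borel" for j unfolding Y_def by measurable
    have Mg: "weighted_maximal w (g j) x \<le> ennreal K * s x * Y j x" for j x
      unfolding Y_def v_def
    proof (rule weighted_maximal_change_weight(2)[OF _ _ _ A1 fin])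
      fix n assume "(\<integral>\<^sup>+y\<in>rat_interval n. s y * w y \<partial>lborel) = 0"
      then have "AE y in lborel. s y * w y * indicator (rat_interval n) y = 0"
        by (subst (asm) nn_integral_0_iff_AE) auto
      then have "AE y in lborel. g j y * w y * indicator (rat_interval n) y = 0"
        by eventually_elim (auto simp: g0)
      then show "(\<integral>\<^sup>+y\<in>rat_interval n. g j y * w y \<partial>lborel) = 0"
        by (subst nn_integral_0_iff_AE) auto
    qed (auto simp: g0)
    have "?L \<le> (\<integral>\<^sup>+x. ennreal (K powr r) * (ennpowr (s x) p * w x + (\<Sum>j. ennpowr (Y j x) u) * v x) \<partial>lborel)"
    proof (rule nn_integral_mono)
      fix x
      let ?Y = "ell_norm (ennreal u) (\<lambda>j. Y j x)"
      have "ell_norm (ennreal u) (\<lambda>j. weighted_maximal w (g j) x)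
          \<le> ell_norm (ennreal u) (\<lambda>j. ennreal K * s x * Y j x)"
        by (intro ell_norm_mono u0 Mg)
      also have "\<dots> = ennreal K * (s x * ?Y)"
        unfolding mult.assoc[symmetric] by (rule ell_norm_mult[OF u0(1)])
      finally have "ell_norm (ennreal u) (\<lambda>j. weighted_maximal w (g j) x) \<le> ennreal K * (s x * ?Y)" .
      then have "ennpowr (ell_norm (ennreal u) (\<lambda>j. weighted_maximal w (g j) x)) r
          \<le> ennpowr (ennreal K * (s x * ?Y)) r"
        using r by (intro ennpowr_mono) auto
      also have "\<dots> = ennreal (K powr r) * ennpowr (s x * ?Y) r"
        using r K by (simp add: ennpowr_mult ennpowr_ennreal)
      also have "\<dots> \<le> ennreal (K powr r) * (ennpowr (s x) p + s x * ennpowr ?Y u)"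
        unfolding p_def by (intro mult_left_mono ennpowr_product_split[OF r \<theta>_def]) auto
      finally have "ennpowr (ell_norm (ennreal u) (\<lambda>j. weighted_maximal w (g j) x)) r * w x
         \<le> ennreal (K powr r) * (ennpowr (s x) p + s x * ennpowr ?Y u) * w x"
        by (rule mult_right_mono) simp
      then show "ennpowr (ell_norm (ennreal u) (\<lambda>j. weighted_maximal w (g j) x)) r * w x
         \<le> ennreal (K powr r) * (ennpowr (s x) p * w x + (\<Sum>j. ennpowr (Y j x) u) * v x)"
        using u0 by (simp add: ennpowr_ell_norm_real v_def algebra_simps)
    qed
    also have "\<dots> = ennreal (K powr r) * ((\<integral>\<^sup>+x. ennpowr (s x) p * w x \<partial>lborel)
          + (\<integral>\<^sup>+x. (\<Sum>j. ennpowr (Y j x) u) * v x \<partial>lborel))"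
      by (subst nn_integral_cmult, measurable) (subst nn_integral_add, auto)
    finally have L_le: "?L \<le> ennreal (K powr r) * ((\<integral>\<^sup>+x. ennpowr (s x) p * w x \<partial>lborel)
          + (\<integral>\<^sup>+x. (\<Sum>j. ennpowr (Y j x) u) * v x \<partial>lborel))" .
    have "(\<integral>\<^sup>+x. (\<Sum>j. ennpowr (Y j x) u) * v x \<partial>lborel)
        \<le> ennreal D * (\<integral>\<^sup>+x. (\<Sum>j. ennpowr (g j x / s x) u) * v x \<partial>lborel)"
      unfolding Y_def D_def by (rule vector_maximal_diagonal) (use r in auto)
    also have "(\<integral>\<^sup>+x. (\<Sum>j. ennpowr (g j x / s x) u) * v x \<partial>lborel) \<le> ?R"
    proof (rule nn_integral_mono)
      fix x
      have "(\<Sum>j. ennpowr (g j x / s x) u) = ennpowr (h x / s x) u"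
        using ell_norm_mult[OF u0(1), of "inverse (s x)" "\<lambda>j. g j x"] u0
        by (simp add: divide_ennreal_def h_def mult.commute flip: ennpowr_ell_norm_real)
      then have "(\<Sum>j. ennpowr (g j x / s x) u) * v x = ennpowr (h x / s x) u * s x * w x"
        by (simp add: v_def mult.assoc)
      also have "\<dots> \<le> ennpowr (h x) r * w x"
        by (intro mult_right_mono ennpowr_quotient_bound[OF r \<theta>_def] hs) auto
      finally show "(\<Sum>j. ennpowr (g j x / s x) u) * v x
          \<le> ennpowr (ell_norm (ennreal u) (\<lambda>j. g j x)) r * w x"
        by (simp add: h_def)
    qed
    finally have "(\<integral>\<^sup>+x. (\<Sum>j. ennpowr (Y j x) u) * v x \<partial>lborel) \<le> ennreal D * ?R"
      by (simp add: mult_left_mono)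
    with int have "?L \<le> ennreal (K powr r) * (ennreal K * ?R + ennreal D * ?R)"
      by (intro order_trans[OF L_le] mult_left_mono add_mono) auto
    also have "\<dots> = ennreal C * ?R"
      using K D unfolding C_def distrib_right[symmetric]
      by (subst ennreal_mult) (auto simp: mult.assoc ennreal_plus)
    finally show ?thesis .
  qed
  then show ?thesis using C by blast
qed

text \<open>
  Let \<open>G\<close> be the \<open>l\<^sup>u\<close> norm of the maximal functions. Writing \<open>G\<^sup>r\<close> as \<open>G\<^sup>u\<close> times \<open>G\<close> to the power
  \<open>r - u\<close> and majorizing the second factor by \<open>s\<close> with \<open>M\<^sub>w s \<le> K s\<close>, the bound for equal
  exponents applies to the measure \<open>s w dx\<close>. The resulting right-hand side contains \<open>s\<close>, hence
  the integral of \<open>G\<^sup>r\<close> itself, with a coefficient \<open>1 / 2\<close> that can be absorbed. The absorption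
  needs that integral to be finite; this is known for finitely many functions, and monotone
  convergence gives the general case.
\<close>

lemma vector_maximal_above:
  fixes u r :: real
  assumes r: "1 < u" "u < r"
  shows "\<exists>C>0. \<forall>w\<in>borel_measurable borel. \<forall>g. (\<forall>j. g j \<in> borel_measurable borel) \<longrightarrow>
    (\<integral>\<^sup>+x. ennpowr (ell_norm (ennreal u) (\<lambda>j. weighted_maximal w (g j) x)) r * w x \<partial>lborel)
      \<le> ennreal C * (\<integral>\<^sup>+x. ennpowr (ell_norm (ennreal u) (\<lambda>j. g j x)) r * w x \<partial>lborel)"
proof -
  define p where "p = r / (r - u)"
  have p: "1 < p" using r by (simp add: p_def)
  obtain K where K: "0 < K" and maj: "\<forall>w\<in>borel_measurable borel. \<forall>h\<in>borel_measurable borel. \<exists>s\<in>borel_measurable borel. (\<forall>x. h x \<le> s x) \<and>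
      (\<forall>x. weighted_maximal w s x \<le> ennreal K * s x) \<and>
      (\<integral>\<^sup>+x. ennpowr (s x) p * w x \<partial>lborel) \<le> ennreal K * (\<integral>\<^sup>+x. ennpowr (h x) p * w x \<partial>lborel)"
    using maximal_majorant[OF p] by blast
  define D where "D = K powr u * (2 powr u * (2 * u / (u - 1)))"
  have D: "0 < D" using r K by (simp add: D_def)
  define B where "B = (2 * D * K) powr (1 / u)"
  have B: "0 < B" using D K by (simp add: B_def)
  \<comment> \<open>B is chosen so that the absorbed term has coefficient 1/2\<close>
  have half: "D * (B powr (- u) * K) = 1 / 2"
    using D K r by (simp add: B_def powr_powr powr_minus field_simps)
  define C where "C = 2 * D * B powr (r - u)"
  have C: "0 < C" using B D by (simp add: C_def)
  have u0: "0 < ennreal u" "0 < u" "0 < r" using r by auto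
  have finite_case:
    "(\<integral>\<^sup>+x. ennpowr (ell_norm (ennreal u) (\<lambda>j. weighted_maximal w (g j) x)) r * w x \<partial>lborel)
      \<le> ennreal C * (\<integral>\<^sup>+x. ennpowr (ell_norm (ennreal u) (\<lambda>j. g j x)) r * w x \<partial>lborel)" (is "?L \<le> _ * ?R")
    if [measurable]: "w \<in> borel_measurable borel" "\<And>j. g j \<in> borel_measurable borel"
      and N: "\<And>j. N \<le> j \<Longrightarrow> g j = (\<lambda>_. 0)" for w g and N :: nat
  proof (cases "?R = top")
    case True then show ?thesis using C by (simp add: ennreal_mult_top)
  next
    case False
    define h where "h x = ell_norm (ennreal u) (\<lambda>j. g j x)" for x
    define G where "G x = ell_norm (ennreal u) (\<lambda>j. weighted_maximal w (g j) x)" for x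
    have [measurable]: "h \<in> borel_measurable borel" "G \<in> borel_measurable borel"
      unfolding h_def G_def by measurable
    have gh: "g j x \<le> h x" for j x unfolding h_def by (rule ell_norm_upper) (use r in simp)
    \<comment> \<open>comparison of the finite-dimensional norms with exponents u and r, then the scalar bound\<close>
    have L_fin: "?L < top"
    proof -
      let ?M = "\<lambda>j x. weighted_maximal w (g j) x"
      have G_bound: "ennpowr (G x) r \<le> ennpowr (of_nat N) (r / u) * (\<Sum>j<N. ennpowr (?M j x) r)" for x
      proof -
        have "(\<Sum>j. ennpowr (?M j x) u) = (\<Sum>j<N. ennpowr (?M j x) u)"
          by (rule suminf_finite) (auto simp: N not_less)
        also have "\<dots> \<le> (\<Sum>j<N. ennpowr (\<Sum>j<N. ennpowr (?M j x) r) (u / r))"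
        proof (rule sum_mono)
          fix j assume j: "j \<in> {..<N}"
          have "ennpowr (?M j x) u = ennpowr (ennpowr (?M j x) r) (u / r)"
            using r by (simp add: ennpowr_ennpowr)
          also have "\<dots> \<le> ennpowr (\<Sum>j<N. ennpowr (?M j x) r) (u / r)"
            using r j by (intro ennpowr_mono member_le_sum) auto
          finally show "ennpowr (?M j x) u \<le> ennpowr (\<Sum>j<N. ennpowr (?M j x) r) (u / r)" .
        qed
        finally have "ennpowr (ennpowr (\<Sum>j. ennpowr (?M j x) u) (1 / u)) r
            \<le> ennpowr (ennpowr (of_nat N * ennpowr (\<Sum>j<N. ennpowr (?M j x) r) (u / r)) (1 / u)) r"
          using r by (intro ennpowr_mono) auto
        then show ?thesis
          using r by (simp add: G_def ell_norm_real ennpowr_mult ennpowr_ennpowr)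
      qed
      have "?L \<le> (\<integral>\<^sup>+x. ennpowr (of_nat N) (r / u) * (\<Sum>j<N. ennpowr (?M j x) r * w x) \<partial>lborel)"
        using G_bound unfolding G_def
        by (intro nn_integral_mono) (auto simp: mult.assoc[symmetric] sum_distrib_right[symmetric] intro: mult_right_mono)
      also have "\<dots> = ennpowr (of_nat N) (r / u) * (\<Sum>j<N. \<integral>\<^sup>+x. ennpowr (?M j x) r * w x \<partial>lborel)"
        by (subst nn_integral_cmult, measurable) (subst nn_integral_sum, auto)
      also have "\<dots> \<le> ennpowr (of_nat N) (r / u) * (\<Sum>j<N. ennreal (2 powr r * (2 * r / (r - 1))) * ?R)"
      proof (intro mult_left_mono sum_mono)
        fix j
        have "(\<integral>\<^sup>+x. ennpowr (?M j x) r * w x \<partial>lborel)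
            \<le> ennreal (2 powr r * (2 * r / (r - 1))) * (\<integral>\<^sup>+x. ennpowr (g j x) r * w x \<partial>lborel)"
          by (rule weighted_maximal_strong_type) (use r in auto)
        also have "\<dots> \<le> ennreal (2 powr r * (2 * r / (r - 1))) * ?R"
          using gh r unfolding h_def by (intro mult_left_mono nn_integral_mono mult_right_mono ennpowr_mono) auto
        finally show "(\<integral>\<^sup>+x. ennpowr (?M j x) r * w x \<partial>lborel) \<le> ennreal (2 powr r * (2 * r / (r - 1))) * ?R" .
      qed simp
      also have "\<dots> < top" using False
        by (auto simp: less_top[symmetric] ennreal_mult_eq_top_iff ennreal_of_nat_eq_real_of_nat)
      finally show ?thesis .
    qed
    obtain s where [measurable]: "s \<in> borel_measurable borel" and Gs: "\<And>x. ennpowr (G x) (r - u) \<le> s x"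
      and A1: "\<And>x. weighted_maximal w s x \<le> ennreal K * s x"
      and int: "(\<integral>\<^sup>+x. ennpowr (s x) p * w x \<partial>lborel) \<le> ennreal K * (\<integral>\<^sup>+x. ennpowr (ennpowr (G x) (r - u)) p * w x \<partial>lborel)"
      using maj[rule_format, of w "\<lambda>x. ennpowr (G x) (r - u)"] by auto
    have "(r - u) * p = r" using r by (simp add: p_def)
    then have int: "(\<integral>\<^sup>+x. ennpowr (s x) p * w x \<partial>lborel) \<le> ennreal K * ?L"
      using int by (simp add: ennpowr_ennpowr G_def)
    also have "\<dots> < top" using L_fin by (simp add: ennreal_mult_less_top)
    finally have fin: "(\<integral>\<^sup>+x. ennpowr (s x) p * w x \<partial>lborel) < top" .
    define v where "v x = s x * w x" for x
    have [measurable]: "v \<in> borel_measurable borel" unfolding v_def by measurable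
    define Y where "Y j x = weighted_maximal v (g j) x" for j x
    have [measurable]: "Y j \<in> borel_measurable borel" for j unfolding Y_def by measurable
    have Mg: "weighted_maximal w (g j) x \<le> ennreal K * Y j x" for j x
      unfolding Y_def v_def
    proof (rule weighted_maximal_change_weight(1)[OF _ _ _ A1 fin])
      fix n
      let ?J = "rat_interval n"
      let ?B = "\<integral>\<^sup>+y\<in>?J. w y \<partial>lborel" and ?F = "\<integral>\<^sup>+y\<in>?J. g j y * w y \<partial>lborel"
      \<comment> \<open>on the whole interval G is at least the average of the j-th function, so a vanishing
        integral of s forces this average to vanish\<close>
      assume "?B \<noteq> 0" "?B \<noteq> top" and S: "(\<integral>\<^sup>+y\<in>?J. s y * w y \<partial>lborel) = 0"
      have "ennpowr (?F / ?B) (r - u) * ?B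
          = (\<integral>\<^sup>+y. ennpowr (?F / ?B) (r - u) * (w y * indicator ?J y) \<partial>lborel)"
        by (subst nn_integral_cmult) auto
      also have "\<dots> \<le> (\<integral>\<^sup>+y\<in>?J. s y * w y \<partial>lborel)"
      proof (rule nn_integral_mono)
        fix y
        have "ennpowr (?F / ?B) (r - u) \<le> s y" if "y \<in> ?J"
        proof -
          have "?F / ?B \<le> G y"
            unfolding G_def using weighted_maximal_upper[OF that, of "g j" w]
              ell_norm_upper[OF u0(1), of "\<lambda>j. weighted_maximal w (g j) y" j] by (rule order_trans)
          then show ?thesis using Gs[of y] r ennpowr_mono[of "r - u" "?F / ?B" "G y"] by (auto intro: order_trans)
        qed
        then show "ennpowr (?F / ?B) (r - u) * (w y * indicator ?J y) \<le> s y * w y * indicator ?J y"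
          by (auto simp: mult.assoc intro: mult_right_mono split: split_indicator)
      qed
      finally have "?F / ?B = 0" using S \<open>?B \<noteq> 0\<close> by simp
      then show "?F = 0" using \<open>?B \<noteq> top\<close> by simp
    qed auto
    have "?L = (\<integral>\<^sup>+x. ennpowr (G x) u * ennpowr (G x) (r - u) * w x \<partial>lborel)"
      unfolding ennpowr_add[symmetric] by (simp add: G_def)
    also have "\<dots> \<le> (\<integral>\<^sup>+x. ennreal (K powr u) * ((\<Sum>j. ennpowr (Y j x) u) * v x) \<partial>lborel)"
    proof (rule nn_integral_mono)
      fix x
      let ?Y = "ell_norm (ennreal u) (\<lambda>j. Y j x)"
      have "G x \<le> ell_norm (ennreal u) (\<lambda>j. ennreal K * Y j x)"
        unfolding G_def by (intro ell_norm_mono u0 Mg)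
      also have "\<dots> = ennreal K * ?Y" by (rule ell_norm_mult[OF u0(1)])
      finally have "G x \<le> ennreal K * ?Y" .
      then have "ennpowr (G x) u \<le> ennpowr (ennreal K * ?Y) u"
        using r by (intro ennpowr_mono) auto
      also have "\<dots> = ennreal (K powr u) * (\<Sum>j. ennpowr (Y j x) u)"
        using u0 K by (simp add: ennpowr_mult ennpowr_ennreal ennpowr_ell_norm_real)
      finally have "ennpowr (G x) u * ennpowr (G x) (r - u) \<le> ennreal (K powr u) * (\<Sum>j. ennpowr (Y j x) u) * s x"
        using Gs by (rule mult_mono) auto
      from mult_right_mono[OF this, of "w x"]
      show "ennpowr (G x) u * ennpowr (G x) (r - u) * w x \<le> ennreal (K powr u) * ((\<Sum>j. ennpowr (Y j x) u) * v x)"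
        by (simp add: v_def mult.assoc)
    qed
    also have "\<dots> = ennreal (K powr u) * (\<integral>\<^sup>+x. (\<Sum>j. ennpowr (Y j x) u) * v x \<partial>lborel)"
      by (rule nn_integral_cmult) measurable
    also have "\<dots> \<le> ennreal (K powr u) * (ennreal (2 powr u * (2 * u / (u - 1)))
          * (\<integral>\<^sup>+x. (\<Sum>j. ennpowr (g j x) u) * v x \<partial>lborel))"
      unfolding Y_def by (intro mult_left_mono vector_maximal_diagonal) (use r in auto)
    also have "\<dots> = ennreal D * (\<integral>\<^sup>+x. (\<Sum>j. ennpowr (g j x) u) * v x \<partial>lborel)"
      using r unfolding D_def by (subst (2) ennreal_mult) (auto simp: mult.assoc)
    also have "(\<integral>\<^sup>+x. (\<Sum>j. ennpowr (g j x) u) * v x \<partial>lborel)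
        \<le> (\<integral>\<^sup>+x. ennreal (B powr (- u)) * (ennpowr (s x) p * w x)
               + ennreal (B powr (r - u)) * (ennpowr (h x) r * w x) \<partial>lborel)"
    proof (rule nn_integral_mono)
      fix x
      have "ennpowr (h x) u * s x \<le> ennreal (B powr (- u)) * ennpowr (s x) p
               + ennreal (B powr (r - u)) * ennpowr (h x) r"
        unfolding p_def by (rule ennpowr_absorb) (use u0 r B in auto)
      from mult_right_mono[OF this, of "w x"]
      show "(\<Sum>j. ennpowr (g j x) u) * v x \<le> ennreal (B powr (- u)) * (ennpowr (s x) p * w x)
               + ennreal (B powr (r - u)) * (ennpowr (h x) r * w x)"
        using u0 by (simp add: ennpowr_ell_norm_real v_def h_def algebra_simps)
    qed
    also have "\<dots> = ennreal (B powr (- u)) * (\<integral>\<^sup>+x. ennpowr (s x) p * w x \<partial>lborel)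
               + ennreal (B powr (r - u)) * ?R"
      unfolding h_def by (subst nn_integral_add, measurable) (subst (1 2) nn_integral_cmult, auto)
    also have "\<dots> \<le> ennreal (B powr (- u)) * (ennreal K * ?L) + ennreal (B powr (r - u)) * ?R"
      using int by (intro add_mono mult_left_mono) auto
    finally have "?L \<le> ennreal D * (ennreal (B powr (- u)) * (ennreal K * ?L) + ennreal (B powr (r - u)) * ?R)"
      by (simp add: mult_left_mono)
    also have "\<dots> = ennreal (D * (B powr (- u) * K)) * ?L + ennreal (D * B powr (r - u)) * ?R"
      using D K by (simp add: ennreal_mult distrib_left mult.assoc)
    finally have *: "?L \<le> ennreal (1 / 2) * ?L + ennreal (D * B powr (r - u)) * ?R"
      unfolding half .
    obtain l where l: "?L = ennreal l" "0 \<le> l" using L_fin by (cases ?L) auto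
    obtain m where m: "?R = ennreal m" "0 \<le> m" using False by (cases ?R) auto
    have "l \<le> 1 / 2 * l + D * B powr (r - u) * m"
    proof -
      have nn: "0 \<le> 1 / 2 * l" "0 \<le> D * B powr (r - u) * m" using D l m by auto
      have "ennreal (1 / 2 * l + D * B powr (r - u) * m)
          = ennreal (1 / 2) * ennreal l + ennreal (D * B powr (r - u)) * ennreal m"
        unfolding ennreal_plus[OF nn] using D l m
        by (intro arg_cong2[where f = "(+)"] ennreal_mult) auto
      then have "ennreal l \<le> ennreal (1 / 2 * l + D * B powr (r - u) * m)"
        using * unfolding l(1) m(1) by simp
      then show ?thesis using nn by (subst (asm) ennreal_le_iff) auto
    qed
    then have "l \<le> C * m" by (simp add: C_def)
    then show ?thesis unfolding l(1) m(1) using C m by (simp add: ennreal_leI flip: ennreal_mult)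
  qed
  have "(\<integral>\<^sup>+x. ennpowr (ell_norm (ennreal u) (\<lambda>j. weighted_maximal w (g j) x)) r * w x \<partial>lborel)
      \<le> ennreal C * (\<integral>\<^sup>+x. ennpowr (ell_norm (ennreal u) (\<lambda>j. g j x)) r * w x \<partial>lborel)" (is "?L \<le> _ * ?R")
    if [measurable]: "w \<in> borel_measurable borel" "\<And>j. g j \<in> borel_measurable borel" for w g
  proof -
    define gN where "gN N j = (if j < N then g j else (\<lambda>_. 0))" for N j :: nat
    define GN where "GN N x = ell_norm (ennreal u) (\<lambda>j. weighted_maximal w (gN N j) x)" for N x
    have [measurable]: "gN N j \<in> borel_measurable borel" for N j unfolding gN_def by simp
    have [measurable]: "GN N \<in> borel_measurable borel" for N unfolding GN_def by measurable
    have gN_le: "gN N j x \<le> gN N' j x" "gN N j x \<le> g j x" if "N \<le> N'" for N N' j x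
      using that by (auto simp: gN_def)
    have "(SUP N. ennpowr (GN N x) r) = ennpowr (ell_norm (ennreal u) (\<lambda>j. weighted_maximal w (g j) x)) r" for x
    proof -
      have "GN N x = ennpowr (\<Sum>j<N. ennpowr (weighted_maximal w (g j) x) u) (1 / u)" for N
      proof -
        have "(\<Sum>j. ennpowr (weighted_maximal w (gN N j) x) u) = (\<Sum>j<N. ennpowr (weighted_maximal w (gN N j) x) u)"
          by (rule suminf_finite) (auto simp: gN_def)
        also have "\<dots> = (\<Sum>j<N. ennpowr (weighted_maximal w (g j) x) u)"
          by (intro sum.cong) (auto simp: gN_def)
        finally show ?thesis using u0 by (simp add: GN_def ell_norm_real)
      qed
      then show ?thesis using u0
        by (simp add: ell_norm_real suminf_eq_SUP ennpowr_SUP)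
    qed
    then have "?L = (\<integral>\<^sup>+x. (SUP N. ennpowr (GN N x) r * w x) \<partial>lborel)"
      by (simp add: SUP_mult_right_ennreal[symmetric])
    also have "\<dots> = (SUP N. \<integral>\<^sup>+x. ennpowr (GN N x) r * w x \<partial>lborel)"
    proof (rule nn_integral_monotone_convergence_SUP)
      show "incseq (\<lambda>N x. ennpowr (GN N x) r * w x)"
        unfolding incseq_def le_fun_def GN_def using u0
        by (auto intro!: mult_right_mono ennpowr_mono ell_norm_mono weighted_maximal_mono gN_le)
    qed measurable
    also have "\<dots> \<le> ennreal C * ?R"
    proof (rule SUP_least)
      fix N
      have "(\<integral>\<^sup>+x. ennpowr (GN N x) r * w x \<partial>lborel)
          \<le> ennreal C * (\<integral>\<^sup>+x. ennpowr (ell_norm (ennreal u) (\<lambda>j. gN N j x)) r * w x \<partial>lborel)"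
        unfolding GN_def by (rule finite_case[of _ _ N]) (auto simp: gN_def)
      also have "\<dots> \<le> ennreal C * ?R"
        using u0 by (intro mult_left_mono nn_integral_mono mult_right_mono ennpowr_mono ell_norm_mono gN_le[of N N]) auto
      finally show "(\<integral>\<^sup>+x. ennpowr (GN N x) r * w x \<partial>lborel) \<le> ennreal C * ?R" .
    qed
    finally show ?thesis .
  qed
  then show ?thesis using C by blast
qed

lemma vector_weighted_maximal:
  fixes r :: real and u :: ennreal
  assumes r: "1 < r" and u: "1 < u"
  shows "\<exists>C>0. \<forall>w\<in>borel_measurable borel. \<forall>g. (\<forall>j. g j \<in> borel_measurable borel) \<longrightarrow>
    (\<integral>\<^sup>+x. ennpowr (ell_norm u (\<lambda>j. weighted_maximal w (g j) x)) r * w x \<partial>lborel)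
      \<le> ennreal C * (\<integral>\<^sup>+x. ennpowr (ell_norm u (\<lambda>j. g j x)) r * w x \<partial>lborel)"
proof (cases u)
  case (real v)
  then have v: "1 < v" "u = ennreal v" using u by (auto simp flip: ennreal_1 simp: ennreal_less_iff)
  consider "r < v" | "r = v" | "v < r" by linarith
  then show ?thesis
  proof cases
    case 1 then show ?thesis using vector_maximal_below[OF r] v by simp
  next
    case 2
    then show ?thesis using vector_maximal_diagonal[OF v(1)] v
      by (intro exI[of _ "2 powr v * (2 * v / (v - 1))"]) (auto simp: ennpowr_ell_norm_real)
  next
    case 3 then show ?thesis using vector_maximal_above[OF v(1)] v by simp
  qed
next
  case top
  let ?C = "2 powr r * (2 * r / (r - 1))"
  have "(\<integral>\<^sup>+x. ennpowr (SUP j. weighted_maximal w (g j) x) r * w x \<partial>lborel)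
      \<le> ennreal ?C * (\<integral>\<^sup>+x. ennpowr (SUP j. g j x) r * w x \<partial>lborel)"
    if [measurable]: "w \<in> borel_measurable borel" "\<And>j. g j \<in> borel_measurable borel" for w and g :: "nat \<Rightarrow> real \<Rightarrow> ennreal"
  proof -
    have [measurable]: "(\<lambda>y. SUP j. g j y) \<in> borel_measurable borel"
      by (rule borel_measurable_SUP[OF countableI_type]) (use that in auto)
    have "(\<integral>\<^sup>+x. ennpowr (SUP j. weighted_maximal w (g j) x) r * w x \<partial>lborel)
        \<le> (\<integral>\<^sup>+x. ennpowr (weighted_maximal w (\<lambda>y. SUP j. g j y) x) r * w x \<partial>lborel)"
      using r by (intro nn_integral_mono mult_right_mono ennpowr_mono SUP_least weighted_maximal_mono SUP_upper) auto
    also have "\<dots> \<le> ennreal ?C * (\<integral>\<^sup>+x. ennpowr (SUP j. g j x) r * w x \<partial>lborel)"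
      by (rule weighted_maximal_strong_type) (use r in auto)
    finally show ?thesis .
  qed
  then show ?thesis using top r
    by (intro exI[of _ ?C]) (auto simp: ell_norm_def)
qed

section \<open>Slowly decaying weights and integration along lines\<close>

definition decay_weight :: "real \<Rightarrow> real \<Rightarrow> real \<Rightarrow> real \<Rightarrow> ennreal" where
  "decay_weight \<eta> l c s = ennreal ((l + \<bar>s - c\<bar>) powr (- \<eta>))"

lemma decay_weight_measurable [measurable]: "decay_weight \<eta> l c \<in> borel_measurable borel"
  unfolding decay_weight_def by measurable

lemma decay_weight_integral:
  assumes \<eta>: "0 < \<eta>" "\<eta> < 1" and l: "0 < l" and R: "0 \<le> R"
  shows "(\<integral>\<^sup>+s\<in>{c - R..c + R}. decay_weight \<eta> l c s \<partial>lborel) \<le> ennreal (2 * (l + R) powr (1 - \<eta>) / (1 - \<eta>))"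
proof -
  define e where "e = 1 - \<eta>"
  have e: "0 < e" "- \<eta> = e - 1" using \<eta> by (auto simp: e_def)
  have outer: "((\<lambda>z. z powr e / e) has_real_derivative z powr (e - 1)) (at z)" if "0 < z" for z
    using DERIV_cdivide[OF has_real_derivative_powr[OF that, of e], of e] e(1) by simp
  \<comment> \<open>both halves of the interval are treated by an explicit antiderivative\<close>
  have DERIV: "((\<lambda>s. (l + (s - c)) powr e / e) has_real_derivative (l + (s - c)) powr (e - 1)) (at s)"
    if "c \<le> s" for s
    using DERIV_chain2[OF outer, of "\<lambda>s. l + (s - c)" s 1 UNIV] that l e(1)
    by (auto intro!: derivative_eq_intros)
  have DERIV': "((\<lambda>s. - ((l + (c - s)) powr e / e)) has_real_derivative (l + (c - s)) powr (e - 1)) (at s)"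
    if "s \<le> c" for s
    using DERIV_minus[OF DERIV_chain2[OF outer, of "\<lambda>s. l + (c - s)" s "- 1" UNIV]] that l e(1)
    by (auto intro!: derivative_eq_intros)
  have right: "(\<integral>\<^sup>+s\<in>{c..c + R}. ennreal ((l + (s - c)) powr (- \<eta>)) \<partial>lborel)
      = ennreal ((l + (c + R - c)) powr e / e - (l + (c - c)) powr e / e)"
    unfolding e(2) by (rule nn_integral_FTC_Icc) (use DERIV e(1) l R in auto)
  have left: "(\<integral>\<^sup>+s\<in>{c - R..c}. ennreal ((l + (c - s)) powr (- \<eta>)) \<partial>lborel)
      = ennreal (- ((l + (c - c)) powr e / e) - - ((l + (c - (c - R))) powr e / e))"
    unfolding e(2) by (rule nn_integral_FTC_Icc) (use DERIV' e(1) l R in auto)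
  let ?X = "(l + R) powr (1 - \<eta>) / (1 - \<eta>)"
  have "(\<integral>\<^sup>+s\<in>{c - R..c + R}. decay_weight \<eta> l c s \<partial>lborel)
      \<le> (\<integral>\<^sup>+s. ennreal ((l + (s - c)) powr (- \<eta>)) * indicator {c..c + R} s
           + ennreal ((l + (c - s)) powr (- \<eta>)) * indicator {c - R..c} s \<partial>lborel)"
    by (intro nn_integral_mono) (auto simp: decay_weight_def abs_if split: split_indicator)
  also have "\<dots> = (\<integral>\<^sup>+s\<in>{c..c + R}. ennreal ((l + (s - c)) powr (- \<eta>)) \<partial>lborel)
      + (\<integral>\<^sup>+s\<in>{c - R..c}. ennreal ((l + (c - s)) powr (- \<eta>)) \<partial>lborel)"
    by (rule nn_integral_add) measurable
  also have "\<dots> \<le> ennreal ?X + ennreal ?X"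
    unfolding left right e_def using \<eta> by (intro add_mono ennreal_leI) auto
  also have "\<dots> = ennreal (2 * (l + R) powr (1 - \<eta>) / (1 - \<eta>))"
    using \<eta> by (subst ennreal_plus[symmetric]) auto
  finally show ?thesis .
qed

text \<open>
  If the interval is short compared with \<open>l + |y - c|\<close>, the weight is nearly constant on it.
  Otherwise the interval lies in one centred at \<open>c\<close> of comparable length \<open>L\<close>, whose weighted
  measure is of the order of \<open>L\<close> to the power \<open>1 - \<eta>\<close> because \<open>\<eta> < 1\<close>. The constant
  \<open>20 / (1 - \<eta>)\<close> covers both cases.
\<close>

lemma decay_weight_A1:
  assumes \<eta>: "0 < \<eta>" "\<eta> < 1" and l: "0 < l" and y: "y \<in> {a..b}"
  shows "(\<integral>\<^sup>+s\<in>{a..b}. decay_weight \<eta> l c s \<partial>lborel) \<le> ennreal (20 / (1 - \<eta>) * (b - a)) * decay_weight \<eta> l c y"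
proof -
  define D where "D = l + \<bar>y - c\<bar>"
  define L where "L = b - a"
  have D: "0 < D" and L: "0 \<le> L" using l y by (auto simp: D_def L_def)
  have wy: "decay_weight \<eta> l c y = ennreal (D powr (- \<eta>))" by (simp add: decay_weight_def D_def)
  have two: "2 powr \<eta> \<le> (2::real)" using powr_mono[of \<eta> 1 2] \<eta> by simp
  have five: "5 powr (1 - \<eta>) \<le> (5::real)" using powr_mono[of "1 - \<eta>" 1 5] \<eta> by simp
  show ?thesis
  proof (cases "L \<le> D / 2")
    case True
    have "decay_weight \<eta> l c s \<le> ennreal (2 * D powr (- \<eta>))" if "s \<in> {a..b}" for s
    proof -
      have "D / 2 \<le> l + \<bar>s - c\<bar>" 
      proof -
        have "\<bar>y - c\<bar> \<le> \<bar>s - c\<bar> + L" using that y by (auto simp: L_def)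
        then have "\<bar>y - c\<bar> \<le> \<bar>s - c\<bar> + (l + \<bar>y - c\<bar>) / 2" using True unfolding D_def by argo
        then show ?thesis using l unfolding D_def by argo
      qed
      then have "(l + \<bar>s - c\<bar>) powr (- \<eta>) \<le> (D / 2) powr (- \<eta>)"
        using D \<eta> by (intro powr_mono2') auto
      also have "\<dots> = 2 powr \<eta> * D powr (- \<eta>)"
        using D by (simp add: powr_divide powr_minus field_simps)
      also have "\<dots> \<le> 2 * D powr (- \<eta>)" using two by (intro mult_right_mono) auto
      finally show ?thesis unfolding decay_weight_def by (rule ennreal_leI)
    qed
    then have "(\<integral>\<^sup>+s\<in>{a..b}. decay_weight \<eta> l c s \<partial>lborel) \<le> (\<integral>\<^sup>+s\<in>{a..b}. ennreal (2 * D powr (- \<eta>)) \<partial>lborel)"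
      by (intro nn_integral_mono) (auto split: split_indicator)
    also have "\<dots> = ennreal (2 * D powr (- \<eta>)) * ennreal L"
      using L by (simp add: nn_integral_cmult_indicator L_def)
    also have "\<dots> = ennreal (2 * L * D powr (- \<eta>))"
      using L by (simp add: ac_simps flip: ennreal_mult)
    also have "\<dots> \<le> ennreal (20 / (1 - \<eta>) * L * D powr (- \<eta>))"
      using \<eta> L by (intro ennreal_leI mult_right_mono) (auto simp: field_simps)
    also have "\<dots> = ennreal (20 / (1 - \<eta>) * L) * decay_weight \<eta> l c y"
      using \<eta> L unfolding wy by (intro ennreal_mult) auto
    finally show ?thesis by (simp add: L_def)
  next
    case False
    then have L: "0 < L" "D < 2 * L" using D by auto
    have "{a..b} \<subseteq> {c - 3 * L..c + 3 * L}"
      using y L l by (auto simp: D_def L_def)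
    then have "(\<integral>\<^sup>+s\<in>{a..b}. decay_weight \<eta> l c s \<partial>lborel)
        \<le> (\<integral>\<^sup>+s\<in>{c - 3 * L..c + 3 * L}. decay_weight \<eta> l c s \<partial>lborel)"
      by (intro nn_integral_mono) (auto split: split_indicator)
    also have "\<dots> \<le> ennreal (2 * (l + 3 * L) powr (1 - \<eta>) / (1 - \<eta>))"
      using \<eta> l L by (intro decay_weight_integral) auto
    also have "\<dots> \<le> ennreal (20 / (1 - \<eta>) * L * D powr (- \<eta>))"
    proof (rule ennreal_leI)
      have "(l + 3 * L) powr (1 - \<eta>) \<le> (5 * L) powr (1 - \<eta>)"
        using L l \<eta> by (intro powr_mono2) (auto simp: D_def)
      also have "\<dots> \<le> 5 * L powr (1 - \<eta>)"
        using five L by (simp add: powr_mult mult_right_mono)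
      also have "L powr (1 - \<eta>) = L * (2 powr \<eta> * (2 * L) powr (- \<eta>))"
        using L by (simp add: powr_diff powr_mult powr_minus field_simps)
      also have "\<dots> \<le> L * (2 * D powr (- \<eta>))"
        using L D \<eta> two by (intro mult_left_mono mult_mono powr_mono2') auto
      finally have "(l + 3 * L) powr (1 - \<eta>) \<le> 10 * L * D powr (- \<eta>)" by simp
      then have "2 * (l + 3 * L) powr (1 - \<eta>) / (1 - \<eta>) \<le> 20 * L * D powr (- \<eta>) / (1 - \<eta>)"
        using \<eta> by (intro divide_right_mono) auto
      then show "2 * (l + 3 * L) powr (1 - \<eta>) / (1 - \<eta>) \<le> 20 / (1 - \<eta>) * L * D powr (- \<eta>)"
        by simp
    qed
    also have "\<dots> = ennreal (20 / (1 - \<eta>) * L) * decay_weight \<eta> l c y"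
      using \<eta> L unfolding wy by (intro ennreal_mult) auto
    finally show ?thesis by (simp add: L_def)
  qed
qed

lemma rat_interval_cases:
  obtains a b where "rat_interval n = {a..b}" "a \<le> b" | "rat_interval n = {}"
  using that unfolding rat_interval_def
  by (cases "from_nat n :: rat \<times> rat") (metis atLeastatMost_empty case_prod_conv linorder_not_le)

lemma rat_interval_exists:
  assumes "a \<in> \<rat>" "b \<in> \<rat>" shows "\<exists>n. rat_interval n = {a..b}"
proof -
  obtain a' b' where "a = of_rat a'" "b = of_rat b'" using assms by (auto elim!: Rats_cases)
  then have "rat_interval (to_nat (a', b')) = {a..b}" by (simp add: rat_interval_def)
  then show ?thesis ..
qed

text \<open>
  An \<open>A\<^sub>1\<close> weight satisfies \<open>1 / |J| \<le> A w(y) / w(J)\<close> for every point \<open>y\<close> of an interval \<open>J\<close>;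
  integrating \<open>f\<close> over \<open>J\<close> against both sides compares the two averages.
\<close>

lemma unweighted_le_decay_weighted_maximal:
  assumes \<eta>: "0 < \<eta>" "\<eta> < 1" and l: "0 < l" and [measurable]: "f \<in> borel_measurable borel"
  shows "weighted_maximal (\<lambda>_. 1) f x \<le> ennreal (20 / (1 - \<eta>)) * weighted_maximal (decay_weight \<eta> l c) f x"
proof (rule weighted_maximal_least)
  fix n assume x: "x \<in> rat_interval n"
  let ?w = "decay_weight \<eta> l c" and ?J = "rat_interval n" and ?A = "ennreal (20 / (1 - \<eta>))"
  obtain a b where J: "?J = {a..b}" "a \<le> b" using x by (cases n rule: rat_interval_cases) auto
  have len: "(\<integral>\<^sup>+y\<in>?J. 1 \<partial>lborel) = ennreal (b - a)" using J by simp
  show "(\<integral>\<^sup>+y\<in>?J. f y * 1 \<partial>lborel) / (\<integral>\<^sup>+y\<in>?J. 1 \<partial>lborel) \<le> ?A * weighted_maximal ?w f x"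
  proof (cases "a = b")
    case True
    have "(\<integral>\<^sup>+y\<in>?J. f y * 1 \<partial>lborel) = 0"
      by (rule weighted_average_eq_0) (use len True in auto)
    then show ?thesis by simp
  next
    case False
    with J have ab: "a < b" by simp
    define B F where "B = (\<integral>\<^sup>+y\<in>?J. ?w y \<partial>lborel)" and "F = (\<integral>\<^sup>+y\<in>?J. f y * 1 \<partial>lborel)"
    have A1: "B \<le> ?A * ennreal (b - a) * ?w y" if "y \<in> ?J" for y
    proof -
      have "ennreal (20 / (1 - \<eta>) * (b - a)) = ?A * ennreal (b - a)"
        using ab \<eta> by (intro ennreal_mult) auto
      then show ?thesis
        using decay_weight_A1[OF \<eta> l, of y a b c] that unfolding B_def J(1) by (simp only:)
    qed
    have "B \<le> ?A * ennreal (b - a) * ?w x" by (rule A1[OF x])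
    also have "\<dots> < top" by (simp add: ennreal_mult_less_top decay_weight_def)
    finally have B_fin: "B \<noteq> top" by simp
    have B0: "B \<noteq> 0"
    proof
      assume "B = 0"
      then have "AE y in lborel. ?w y * indicator ?J y = 0"
        unfolding B_def by (subst (asm) nn_integral_0_iff_AE) auto
      then have "AE y in lborel. y \<notin> {a..b}"
        by eventually_elim (use l in \<open>auto simp: decay_weight_def J split: split_indicator_asm\<close>)
      then have "emeasure lborel {a..b} = 0" by (subst (asm) AE_iff_measurable[where N = "{a..b}"]) auto
      then show False using ab by simp
    qed
    have "B * F = (\<integral>\<^sup>+y. B * (f y * 1 * indicator ?J y) \<partial>lborel)"
      unfolding F_def by (rule nn_integral_cmult[symmetric]) measurable
    also have "\<dots> \<le> (\<integral>\<^sup>+y. ?A * ennreal (b - a) * (f y * ?w y * indicator ?J y) \<partial>lborel)"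
    proof (rule nn_integral_mono)
      fix y show "B * (f y * 1 * indicator ?J y) \<le> ?A * ennreal (b - a) * (f y * ?w y * indicator ?J y)"
        using mult_right_mono[OF A1[of y], of "f y"] by (auto simp: ac_simps split: split_indicator)
    qed
    also have "\<dots> = ?A * ennreal (b - a) * (\<integral>\<^sup>+y\<in>?J. f y * ?w y \<partial>lborel)"
      by (rule nn_integral_cmult) measurable
    finally have BF: "B * F \<le> ?A * ennreal (b - a) * (\<integral>\<^sup>+y\<in>?J. f y * ?w y \<partial>lborel)" .
    have "F / ennreal (b - a) = B * F / (ennreal (b - a) * B)"
      using ennreal_divide_cancel[of B 1 F "ennreal (b - a)"] B0 B_fin by simp
    also have "\<dots> \<le> ?A * ennreal (b - a) * (\<integral>\<^sup>+y\<in>?J. f y * ?w y \<partial>lborel) / (B * ennreal (b - a))"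
      unfolding mult.commute[of "ennreal (b - a)" B] by (intro divide_right_mono_ennreal BF)
    also have "\<dots> = ?A * ((\<integral>\<^sup>+y\<in>?J. f y * ?w y \<partial>lborel) / B)"
      using ab by (intro ennreal_divide_cancel) auto
    also have "\<dots> \<le> ?A * weighted_maximal ?w f x"
      unfolding B_def by (intro mult_left_mono weighted_maximal_upper x) auto
    finally show ?thesis unfolding len F_def .
  qed
qed

abbreviation upd_coord :: "'n \<Rightarrow> real^'n::finite \<Rightarrow> real \<Rightarrow> real^'n" where
  "upd_coord k x y \<equiv> (\<chi> i. if i = k then y else x $ i)"

lemma upd_coord_eq: "upd_coord k x y = x + (y - x $ k) *\<^sub>R axis k 1"
  by (simp add: vec_eq_iff axis_def)

lemma vec_nth_measurable [measurable]: "(\<lambda>x::real^'n::finite. x $ i) \<in> borel_measurable borel"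
  by (intro borel_measurable_continuous_onI continuous_intros)

lemma upd_coord_measurable [measurable (raw)]:
  fixes f :: "'a \<Rightarrow> real^'n::finite"
  assumes [measurable]: "f \<in> borel_measurable M" "g \<in> borel_measurable M"
  shows "(\<lambda>z. upd_coord k (f z) (g z)) \<in> borel_measurable M"
  unfolding upd_coord_eq by measurable

lemma upd_coord_twice: "upd_coord k (upd_coord k x y) z = upd_coord k x z"
  by (simp add: vec_eq_iff)

lemma nn_integral_lborel_translate:
  fixes f :: "'a::euclidean_space \<Rightarrow> ennreal"
  assumes [measurable]: "f \<in> borel_measurable borel"
  shows "(\<integral>\<^sup>+x. f (c + x) \<partial>lborel) = (\<integral>\<^sup>+x. f x \<partial>lborel)"
proof -
  have "(\<integral>\<^sup>+x. f x \<partial>lborel) = (\<integral>\<^sup>+x. f x \<partial>distr lborel borel ((+) c))"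
    by (simp add: lborel_distr_plus)
  also have "\<dots> = (\<integral>\<^sup>+x. f (c + x) \<partial>lborel)" by (rule nn_integral_distr) auto
  finally show ?thesis ..
qed

text \<open>
  Tonelli's theorem for one coordinate, obtained from translation invariance: averaging over
  the shifts \<open>x + s e\<^sub>k\<close> leaves the integral of \<open>H\<close> unchanged once the shifts are normalized
  by the cut-off \<open>0 \<le> x\<^sub>k \<le> 1\<close>. This avoids splitting the space into a product.
\<close>

lemma nn_integral_along_lines:
  fixes H :: "real^'n::finite \<Rightarrow> ennreal"
  assumes [measurable]: "H \<in> borel_measurable borel"
  shows "(\<integral>\<^sup>+x. H x \<partial>lborel)
    = (\<integral>\<^sup>+x. indicator {0..1} (x $ k) * (\<integral>\<^sup>+y. H (upd_coord k x y) \<partial>lborel) \<partial>lborel)"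
proof -
  let ?e = "axis k 1 :: real^'n" and ?\<chi> = "indicator {0..1::real} :: real \<Rightarrow> ennreal"
  have "(\<integral>\<^sup>+x. ?\<chi> (x $ k) * (\<integral>\<^sup>+y. H (upd_coord k x y) \<partial>lborel) \<partial>lborel)
      = (\<integral>\<^sup>+x. \<integral>\<^sup>+s. ?\<chi> (x $ k) * H (s *\<^sub>R ?e + x) \<partial>lborel \<partial>lborel)"
  proof (rule nn_integral_cong)
    fix x
    have "(\<integral>\<^sup>+y. H (upd_coord k x y) \<partial>lborel) = (\<integral>\<^sup>+s. H (upd_coord k x (x $ k + s)) \<partial>lborel)"
      by (rule nn_integral_lborel_translate[symmetric]) measurable
    then show "?\<chi> (x $ k) * (\<integral>\<^sup>+y. H (upd_coord k x y) \<partial>lborel) = (\<integral>\<^sup>+s. ?\<chi> (x $ k) * H (s *\<^sub>R ?e + x) \<partial>lborel)"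
      by (simp add: upd_coord_eq add.commute nn_integral_cmult)
  qed
  also have "\<dots> = (\<integral>\<^sup>+s. \<integral>\<^sup>+x. ?\<chi> (x $ k) * H (s *\<^sub>R ?e + x) \<partial>lborel \<partial>lborel)"
    by (rule lborel_pair.Fubini'[symmetric]) measurable
  also have "\<dots> = (\<integral>\<^sup>+s. \<integral>\<^sup>+x. ?\<chi> (x $ k - s) * H x \<partial>lborel \<partial>lborel)"
  proof (rule nn_integral_cong)
    fix s
    show "(\<integral>\<^sup>+x. ?\<chi> (x $ k) * H (s *\<^sub>R ?e + x) \<partial>lborel) = (\<integral>\<^sup>+x. ?\<chi> (x $ k - s) * H x \<partial>lborel)"
      using nn_integral_lborel_translate[of "\<lambda>x. ?\<chi> (x $ k - s) * H x" "s *\<^sub>R ?e"] by simp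
  qed
  also have "\<dots> = (\<integral>\<^sup>+x. \<integral>\<^sup>+s. ?\<chi> (x $ k - s) * H x \<partial>lborel \<partial>lborel)"
    by (rule lborel_pair.Fubini') measurable
  also have "\<dots> = (\<integral>\<^sup>+x. H x \<partial>lborel)"
  proof (rule nn_integral_cong)
    fix x
    have "(\<integral>\<^sup>+s. ?\<chi> (x $ k - s) \<partial>lborel) = (\<integral>\<^sup>+s. indicator {x $ k - 1..x $ k} s \<partial>lborel)"
      by (intro nn_integral_cong) (auto split: split_indicator)
    then show "(\<integral>\<^sup>+s. ?\<chi> (x $ k - s) * H x \<partial>lborel) = H x"
      by (simp add: nn_integral_multc)
  qed
  finally show ?thesis ..
qed

text \<open>
  A measurable substitute for \<^const>\<open>dir_maximal\<close>. The factor 2 pays for enlarging an interval to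
  one with rational endpoints and at most twice the length.
\<close>

definition dir_maximal_rat :: "'n::finite \<Rightarrow> (real^'n \<Rightarrow> ennreal) \<Rightarrow> real^'n \<Rightarrow> ennreal" where
  "dir_maximal_rat k F x = 2 * weighted_maximal (\<lambda>_. 1) (\<lambda>y. F (upd_coord k x y)) (x $ k)"

lemma dir_maximal_rat_mono:
  "(\<And>y. F y \<le> G y) \<Longrightarrow> dir_maximal_rat k F x \<le> dir_maximal_rat k G x"
  unfolding dir_maximal_rat_def by (intro mult_left_mono weighted_maximal_mono) auto

lemma dir_maximal_rat_measurable [measurable]:
  assumes [measurable]: "F \<in> borel_measurable borel"
  shows "dir_maximal_rat k F \<in> borel_measurable borel"
  unfolding dir_maximal_rat_def weighted_maximal_def by measurable

lemma dir_maximal_le_rat: "dir_maximal k F x \<le> dir_maximal_rat k F x"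
  unfolding dir_maximal_def
proof (rule SUP_least, clarify)
  fix a b assume ab: "a < b" "x $ k \<in> {a..b}"
  obtain a' where a': "a' \<in> \<rat>" "a - (b - a) / 2 < a'" "a' < a"
    using Rats_dense_in_real[of "a - (b - a) / 2" a] ab by auto
  obtain b' where b': "b' \<in> \<rat>" "b < b'" "b' < b + (b - a) / 2"
    using Rats_dense_in_real[of b "b + (b - a) / 2"] ab by auto
  obtain n where n: "rat_interval n = {a'..b'}" using rat_interval_exists a' b' by blast
  let ?f = "\<lambda>y. F (upd_coord k x y)"
  let ?X = "\<integral>\<^sup>+y\<in>{a..b}. ?f y \<partial>lborel" and ?Y = "\<integral>\<^sup>+y\<in>{a'..b'}. ?f y \<partial>lborel"
  have XY: "?X \<le> ?Y" using a' b' by (intro nn_integral_mono) (auto split: split_indicator)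
  have "inverse (ennreal (b - a)) \<le> 2 * inverse (ennreal (b' - a'))"
  proof -
    have "1 / (b - a) \<le> 2 / (b' - a')" using a' b' ab by (simp add: field_simps)
    then have "ennreal (inverse (b - a)) \<le> ennreal (2 * inverse (b' - a'))"
      by (intro ennreal_leI) (simp add: divide_inverse)
    then show ?thesis using a' b' ab by (simp add: inverse_ennreal ennreal_mult)
  qed
  then have "?X / ennreal (b - a) \<le> ?Y * (2 * inverse (ennreal (b' - a')))"
    unfolding divide_ennreal_def by (intro mult_mono XY) auto
  also have "\<dots> = 2 * (?Y / ennreal (b' - a'))" by (simp add: divide_ennreal_def ac_simps)
  also have "?Y / ennreal (b' - a') \<le> weighted_maximal (\<lambda>_. 1) ?f (x $ k)"
    using weighted_maximal_upper[of "x $ k" n ?f "\<lambda>_. 1"] n a' b' ab by simp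
  finally show "(\<integral>\<^sup>+y\<in>{a..b}. ?f y \<partial>lebesgue) / ennreal (b - a) \<le> dir_maximal_rat k F x"
    unfolding dir_maximal_rat_def nn_integral_completion by (simp add: mult_left_mono)
qed

lemma fold_dir_maximal_le_rat:
  "(\<And>y. F y \<le> G y) \<Longrightarrow> fold dir_maximal ks F x \<le> fold dir_maximal_rat ks G x"
proof (induction ks arbitrary: F G)
  case (Cons k ks)
  have "dir_maximal k F y \<le> dir_maximal_rat k G y" for y
    using dir_maximal_le_rat dir_maximal_rat_mono[OF Cons.prems] by (rule order_trans)
  then show ?case by (simp add: Cons.IH)
qed simp

definition cube_weight :: "real \<Rightarrow> real \<Rightarrow> real^'n::finite \<Rightarrow> real^'n \<Rightarrow> ennreal" where
  "cube_weight \<eta> l c x = (\<Prod>i\<in>UNIV. decay_weight \<eta> l (c $ i) (x $ i))"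

lemma cube_weight_measurable [measurable]: "cube_weight \<eta> l c \<in> borel_measurable borel"
  unfolding cube_weight_def by measurable

text \<open>
  On a line in direction \<open>k\<close> the product weight is a constant multiple of its \<open>k\<close>-th factor, so
  the one-dimensional theorem applies on each line with the same constant.
\<close>

lemma dir_maximal_rat_weighted:
  fixes r \<eta> :: real and u :: ennreal
  assumes r: "1 < r" and u: "1 < u" and \<eta>: "0 < \<eta>" "\<eta> < 1"
  shows "\<exists>C>0. \<forall>(k::'n::finite) l c G. 0 < l \<longrightarrow> (\<forall>j. G j \<in> borel_measurable borel) \<longrightarrow>
    (\<integral>\<^sup>+x. ennpowr (ell_norm u (\<lambda>j. dir_maximal_rat k (G j) x)) r * cube_weight \<eta> l c x \<partial>lborel)
      \<le> ennreal C * (\<integral>\<^sup>+x. ennpowr (ell_norm u (\<lambda>j. G j x)) r * cube_weight \<eta> l c x \<partial>lborel)"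
proof -
  obtain C where C: "0 < C" and vec: "\<forall>w\<in>borel_measurable borel. \<forall>g. (\<forall>j. g j \<in> borel_measurable borel) \<longrightarrow>
    (\<integral>\<^sup>+x. ennpowr (ell_norm u (\<lambda>j. weighted_maximal w (g j) x)) r * w x \<partial>lborel)
      \<le> ennreal C * (\<integral>\<^sup>+x. ennpowr (ell_norm u (\<lambda>j. g j x)) r * w x \<partial>lborel)"
    using vector_weighted_maximal[OF r u] by blast
  define A where "A = 2 * (20 / (1 - \<eta>))"
  have A: "0 < A" using \<eta> by (simp add: A_def)
  have u0: "0 < u" using u by (rule less_trans[rotated]) simp
  have "(\<integral>\<^sup>+x. ennpowr (ell_norm u (\<lambda>j. dir_maximal_rat k (G j) x)) r * cube_weight \<eta> l c x \<partial>lborel)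
      \<le> ennreal (A powr r * C) * (\<integral>\<^sup>+x. ennpowr (ell_norm u (\<lambda>j. G j x)) r * cube_weight \<eta> l c x \<partial>lborel)"
    if l: "0 < l" and [measurable]: "\<And>j. G j \<in> borel_measurable borel"
    for k :: 'n and l c and G :: "nat \<Rightarrow> real^'n \<Rightarrow> ennreal"
  proof -
    let ?W = "cube_weight \<eta> l c" and ?w = "decay_weight \<eta> l (c $ k)"
    define P where "P x = (\<Prod>i\<in>UNIV - {k}. decay_weight \<eta> l (c $ i) (x $ i))" for x :: "real^'n"
    have W: "?W (upd_coord k x y) = ?w y * P x" for x y
      unfolding cube_weight_def P_def by (subst prod.remove[of _ k]) (auto intro!: prod.cong)
    have line: "(\<integral>\<^sup>+y. ennpowr (ell_norm u (\<lambda>j. dir_maximal_rat k (G j) (upd_coord k x y))) r * ?W (upd_coord k x y) \<partial>lborel)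
      \<le> ennreal (A powr r * C) * (\<integral>\<^sup>+y. ennpowr (ell_norm u (\<lambda>j. G j (upd_coord k x y))) r * ?W (upd_coord k x y) \<partial>lborel)" for x
    proof -
      let ?g = "\<lambda>j y. G j (upd_coord k x y)"
      have "(\<integral>\<^sup>+y. ennpowr (ell_norm u (\<lambda>j. dir_maximal_rat k (G j) (upd_coord k x y))) r * ?W (upd_coord k x y) \<partial>lborel)
        \<le> (\<integral>\<^sup>+y. ennreal (A powr r) * P x * (ennpowr (ell_norm u (\<lambda>j. weighted_maximal ?w (?g j) y)) r * ?w y) \<partial>lborel)"
      proof (rule nn_integral_mono)
        fix y
        have "dir_maximal_rat k (G j) (upd_coord k x y) \<le> ennreal A * weighted_maximal ?w (?g j) y" for j
        proof -
          have "dir_maximal_rat k (G j) (upd_coord k x y) = 2 * weighted_maximal (\<lambda>_. 1) (?g j) y"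
            unfolding dir_maximal_rat_def upd_coord_twice by simp
          also have "\<dots> \<le> 2 * (ennreal (20 / (1 - \<eta>)) * weighted_maximal ?w (?g j) y)"
            using \<eta> l by (intro mult_left_mono unweighted_le_decay_weighted_maximal) auto
          also have "\<dots> = ennreal A * weighted_maximal ?w (?g j) y"
            unfolding A_def by (subst ennreal_mult) (use \<eta> in \<open>auto simp: mult.assoc\<close>)
          finally show ?thesis .
        qed
        then have "ell_norm u (\<lambda>j. dir_maximal_rat k (G j) (upd_coord k x y))
            \<le> ennreal A * ell_norm u (\<lambda>j. weighted_maximal ?w (?g j) y)"
          unfolding ell_norm_mult[OF u0, symmetric] by (intro ell_norm_mono u0)
        then have "ennpowr (ell_norm u (\<lambda>j. dir_maximal_rat k (G j) (upd_coord k x y))) r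
            \<le> ennpowr (ennreal A * ell_norm u (\<lambda>j. weighted_maximal ?w (?g j) y)) r"
          using r by (intro ennpowr_mono) auto
        also have "\<dots> = ennreal (A powr r) * ennpowr (ell_norm u (\<lambda>j. weighted_maximal ?w (?g j) y)) r"
          using r A by (simp add: ennpowr_mult ennpowr_ennreal)
        finally show "ennpowr (ell_norm u (\<lambda>j. dir_maximal_rat k (G j) (upd_coord k x y))) r * ?W (upd_coord k x y)
            \<le> ennreal (A powr r) * P x * (ennpowr (ell_norm u (\<lambda>j. weighted_maximal ?w (?g j) y)) r * ?w y)"
          unfolding W by (rule order_trans[OF mult_right_mono]) (auto simp: ac_simps)
      qed
      also have "\<dots> = ennreal (A powr r) * P x * (\<integral>\<^sup>+y. ennpowr (ell_norm u (\<lambda>j. weighted_maximal ?w (?g j) y)) r * ?w y \<partial>lborel)"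
        by (rule nn_integral_cmult) measurable
      also have "\<dots> \<le> ennreal (A powr r) * P x * (ennreal C * (\<integral>\<^sup>+y. ennpowr (ell_norm u (\<lambda>j. ?g j y)) r * ?w y \<partial>lborel))"
        by (intro mult_left_mono vec[rule_format]) auto
      also have "\<dots> = ennreal (A powr r * C) * (\<integral>\<^sup>+y. P x * (ennpowr (ell_norm u (\<lambda>j. ?g j y)) r * ?w y) \<partial>lborel)"
        using C by (subst nn_integral_cmult, measurable) (simp add: ennreal_mult ac_simps)
      finally show ?thesis unfolding W by (simp add: ac_simps)
    qed
    have "(\<integral>\<^sup>+x. ennpowr (ell_norm u (\<lambda>j. dir_maximal_rat k (G j) x)) r * ?W x \<partial>lborel)
        \<le> (\<integral>\<^sup>+x. ennreal (A powr r * C) * (indicator {0..1} (x $ k) *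
            (\<integral>\<^sup>+y. ennpowr (ell_norm u (\<lambda>j. G j (upd_coord k x y))) r * ?W (upd_coord k x y) \<partial>lborel)) \<partial>lborel)"
    proof (subst nn_integral_along_lines[where k = k], measurable, rule nn_integral_mono)
      fix x
      show "indicator {0..1} (x $ k) *
          (\<integral>\<^sup>+y. ennpowr (ell_norm u (\<lambda>j. dir_maximal_rat k (G j) (upd_coord k x y))) r * ?W (upd_coord k x y) \<partial>lborel)
        \<le> ennreal (A powr r * C) * (indicator {0..1} (x $ k) *
            (\<integral>\<^sup>+y. ennpowr (ell_norm u (\<lambda>j. G j (upd_coord k x y))) r * ?W (upd_coord k x y) \<partial>lborel))"
        using mult_left_mono[OF line[of x], of "indicator {0..1} (x $ k)"] by (simp add: mult.left_commute)
    qed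
    also have "\<dots> = ennreal (A powr r * C) * (\<integral>\<^sup>+x. ennpowr (ell_norm u (\<lambda>j. G j x)) r * ?W x \<partial>lborel)"
      by (subst nn_integral_cmult, measurable) (subst nn_integral_along_lines[where k = k, symmetric], auto)
    finally show ?thesis .
  qed
  then show ?thesis using C A by (intro exI[of _ "A powr r * C"]) auto
qed

lemma fold_dir_maximal_rat_weighted:
  fixes r \<eta> :: real and u :: ennreal and ks :: "'n::finite list"
  assumes r: "1 < r" and u: "1 < u" and \<eta>: "0 < \<eta>" "\<eta> < 1"
  shows "\<exists>C>0. \<forall>l c G. 0 < l \<longrightarrow> (\<forall>j. G j \<in> borel_measurable borel) \<longrightarrow>
    (\<integral>\<^sup>+x. ennpowr (ell_norm u (\<lambda>j. fold dir_maximal_rat ks (G j) x)) r * cube_weight \<eta> l c x \<partial>lborel)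
      \<le> ennreal C * (\<integral>\<^sup>+x. ennpowr (ell_norm u (\<lambda>j. G j x)) r * cube_weight \<eta> l c x \<partial>lborel)"
proof (induction ks)
  case Nil
  show ?case by (intro exI[of _ 1]) auto
next
  case (Cons k ks)
  obtain C where C: "0 < C" and IH: "\<forall>l c G. 0 < l \<longrightarrow> (\<forall>j. G j \<in> borel_measurable borel) \<longrightarrow>
    (\<integral>\<^sup>+x. ennpowr (ell_norm u (\<lambda>j. fold dir_maximal_rat ks (G j) x)) r * cube_weight \<eta> l c x \<partial>lborel)
      \<le> ennreal C * (\<integral>\<^sup>+x. ennpowr (ell_norm u (\<lambda>j. G j x)) r * cube_weight \<eta> l c x \<partial>lborel)"
    using Cons.IH by blast
  obtain C' where C': "0 < C'" and step: "\<forall>(k::'n) l c G. 0 < l \<longrightarrow> (\<forall>j. G j \<in> borel_measurable borel) \<longrightarrow>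
    (\<integral>\<^sup>+x. ennpowr (ell_norm u (\<lambda>j. dir_maximal_rat k (G j) x)) r * cube_weight \<eta> l c x \<partial>lborel)
      \<le> ennreal C' * (\<integral>\<^sup>+x. ennpowr (ell_norm u (\<lambda>j. G j x)) r * cube_weight \<eta> l c x \<partial>lborel)"
    using dir_maximal_rat_weighted[OF r u \<eta>] by blast
  show ?case
  proof (intro exI[of _ "C * C'"] conjI allI impI)
    fix l :: real and c and G :: "nat \<Rightarrow> real^'n \<Rightarrow> ennreal"
    assume l: "0 < l" and G: "\<forall>j. G j \<in> borel_measurable borel"
    have "(\<integral>\<^sup>+x. ennpowr (ell_norm u (\<lambda>j. fold dir_maximal_rat (k # ks) (G j) x)) r * cube_weight \<eta> l c x \<partial>lborel)
        \<le> ennreal C * (\<integral>\<^sup>+x. ennpowr (ell_norm u (\<lambda>j. dir_maximal_rat k (G j) x)) r * cube_weight \<eta> l c x \<partial>lborel)"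
      using IH[rule_format, of l "\<lambda>j. dir_maximal_rat k (G j)" c] l G dir_maximal_rat_measurable by auto
    also have "\<dots> \<le> ennreal C * (ennreal C' * (\<integral>\<^sup>+x. ennpowr (ell_norm u (\<lambda>j. G j x)) r * cube_weight \<eta> l c x \<partial>lborel))"
      using l G by (intro mult_left_mono step[rule_format]) auto
    finally show "(\<integral>\<^sup>+x. ennpowr (ell_norm u (\<lambda>j. fold dir_maximal_rat (k # ks) (G j) x)) r * cube_weight \<eta> l c x \<partial>lborel)
        \<le> ennreal (C * C') * (\<integral>\<^sup>+x. ennpowr (ell_norm u (\<lambda>j. G j x)) r * cube_weight \<eta> l c x \<partial>lborel)"
      using C C' by (simp add: ennreal_mult mult.assoc)
  qed (use C C' in simp)
qed

section \<open>Morrey norms and weighted integrals\<close>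

lemma measure_axis_cube:
  fixes a :: "real^'n::finite"
  assumes "0 < l" shows "measure lebesgue (cbox a (\<chi> i. a $ i + l)) = l ^ CARD('n)"
proof -
  have "measure lebesgue (cbox a (\<chi> i. a $ i + l)) = measure lborel (cbox a (\<chi> i. a $ i + l))" by simp
  also have "\<dots> = l ^ CARD('n)"
    using assms by (subst content_cbox_cart) (auto simp: interval_ne_empty_cart less_imp_le)
  finally show ?thesis .
qed

lemma morrey_norm_cube_bound:
  fixes a :: "real^'n::finite"
  assumes q: "0 < q" and l: "0 < l"
  shows "(\<integral>\<^sup>+x\<in>cbox a (\<chi> i. a $ i + l). ennpowr (g x) q \<partial>lborel)
    \<le> ennpowr (morrey_norm p q g) q * ennreal (l powr (real CARD('n) * (1 - q / p)))" (is "?I \<le> _")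
proof -
  let ?Q = "cbox a (\<chi> i. a $ i + l)"
  define V where "V = l powr real CARD('n)"
  have V: "0 < V" using l by (simp add: V_def)
  have "ennreal (measure lebesgue ?Q powr (1 / p - 1 / q)) * ennpowr (\<integral>\<^sup>+x\<in>?Q. ennpowr (g x) q \<partial>lebesgue) (1 / q)
      \<le> morrey_norm p q g"
    unfolding morrey_norm_def by (rule SUP_upper) (use l in \<open>auto simp: axis_cubes_def\<close>)
  then have "ennreal (V powr (1 / p - 1 / q)) * ennpowr ?I (1 / q) \<le> morrey_norm p q g"
    unfolding measure_axis_cube[OF l] nn_integral_completion V_def powr_realpow[OF l] .
  then have "ennpowr (ennreal (V powr (1 / p - 1 / q)) * ennpowr ?I (1 / q)) q \<le> ennpowr (morrey_norm p q g) q"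
    using q by (intro ennpowr_mono) auto
  moreover have "(1 / p - 1 / q) * q = - (1 - q / p)" using q by (simp add: field_simps)
  ultimately have *: "ennreal (V powr (- (1 - q / p))) * ?I \<le> ennpowr (morrey_norm p q g) q"
    using q by (simp add: ennpowr_mult ennpowr_ennpowr ennpowr_ennreal powr_powr)
  have "?I = ennreal (V powr (1 - q / p)) * (ennreal (V powr (- (1 - q / p))) * ?I)"
    using V by (simp flip: mult.assoc ennreal_mult powr_add)
  also have "\<dots> \<le> ennreal (V powr (1 - q / p)) * ennpowr (morrey_norm p q g) q"
    by (intro mult_left_mono *) simp
  also have "V powr (1 - q / p) = l powr (real CARD('n) * (1 - q / p))"
    by (simp add: V_def powr_powr)
  finally show ?thesis by (simp add: mult.commute)
qed

text \<open>
  Together with the previous lemma, this expresses the Morrey norm by the growth of the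
  integral over cubes, with exponent \<open>n (1 - q / p)\<close> in the side length.
\<close>

lemma morrey_norm_least:
  fixes g :: "real^'n::finite \<Rightarrow> ennreal"
  assumes q: "0 < q"
    and bound: "\<And>a l. 0 < l \<Longrightarrow> (\<integral>\<^sup>+x\<in>cbox a (\<chi> i. a $ i + l). ennpowr (g x) q \<partial>lborel)
      \<le> ennpowr X q * ennreal (l powr (real CARD('n) * (1 - q / p)))"
  shows "morrey_norm p q g \<le> X"
  unfolding morrey_norm_def
proof (rule SUP_least)
  fix Q :: "(real^'n) set" assume "Q \<in> axis_cubes"
  then obtain a l where Q: "Q = cbox a (\<chi> i. a $ i + l)" and l: "0 < l" by (auto simp: axis_cubes_def)
  define V where "V = l powr real CARD('n)"
  have V: "0 < V" using l by (simp add: V_def)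
  have m: "measure lebesgue Q = V" unfolding Q measure_axis_cube[OF l] V_def powr_realpow[OF l] ..
  have "(\<integral>\<^sup>+x\<in>Q. ennpowr (g x) q \<partial>lebesgue) \<le> ennpowr X q * ennreal (V powr (1 - q / p))"
    using bound[OF l, of a] by (simp add: nn_integral_completion Q V_def powr_powr)
  then have "ennpowr (\<integral>\<^sup>+x\<in>Q. ennpowr (g x) q \<partial>lebesgue) (1 / q)
      \<le> ennpowr (ennpowr X q * ennreal (V powr (1 - q / p))) (1 / q)"
    using q by (intro ennpowr_mono) auto
  also have "\<dots> = X * ennreal (V powr ((1 - q / p) * (1 / q)))"
    using q by (simp add: ennpowr_mult ennpowr_ennpowr ennpowr_ennreal powr_powr)
  also have "(1 - q / p) * (1 / q) = - (1 / p - 1 / q)" using q by (simp add: field_simps)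
  finally have "ennreal (V powr (1 / p - 1 / q)) * ennpowr (\<integral>\<^sup>+x\<in>Q. ennpowr (g x) q \<partial>lebesgue) (1 / q)
      \<le> ennreal (V powr (1 / p - 1 / q)) * (X * ennreal (V powr (- (1 / p - 1 / q))))"
    by (rule mult_left_mono) simp
  also have "\<dots> = X * ennreal (V powr (1 / p - 1 / q) * V powr (- (1 / p - 1 / q)))"
    by (simp add: ennreal_mult ac_simps)
  also have "\<dots> = X" using V by (simp flip: powr_add)
  finally show "ennreal (measure lebesgue Q powr (1 / p - 1 / q)) * ennpowr (\<integral>\<^sup>+x\<in>Q. ennpowr (g x) q \<partial>lebesgue) (1 / q) \<le> X"
    by (simp add: m)
qed

text \<open>
  One factor of the weight carries the decay in the maximum distance \<open>d\<close>, the others are at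
  most \<open>l\<close> to the power \<open>- \<eta>\<close>. The summand for the smallest cube containing \<open>x\<close>, with \<open>d\<close> at
  most \<open>2\<^sup>m l\<close>, already suffices.
\<close>

lemma cube_weight_shell_bound:
  fixes c :: "real^'n::finite"
  assumes \<eta>: "0 < \<eta>" "\<eta> < 1" and l: "0 < l"
  shows "cube_weight \<eta> l c x \<le> (\<Sum>m. ennreal (l powr (- (real CARD('n) - 1) * \<eta>) * (2 * (2 ^ m * l) powr (- \<eta>)))
      * indicator (cbox (\<chi> i. c $ i - 2 ^ m * l) (\<chi> i. (c $ i - 2 ^ m * l) + 2 * (2 ^ m * l))) x)"
    (is "_ \<le> (\<Sum>m. ?s m)")
proof -
  let ?S = "range (\<lambda>j. \<bar>x $ j - c $ j\<bar>)"
  have "Max ?S \<in> ?S" by (rule Max_in) auto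
  then obtain i where max: "Max ?S = \<bar>x $ i - c $ i\<bar>" by blast
  have i: "\<bar>x $ j - c $ j\<bar> \<le> \<bar>x $ i - c $ i\<bar>" for j
    unfolding max[symmetric] by (rule Max_ge) auto
  define d where "d = \<bar>x $ i - c $ i\<bar>"
  obtain N :: nat where "d / l < 2 ^ N" using real_arch_pow[of 2 "d / l"] by auto
  then have ex: "\<exists>m. d \<le> 2 ^ m * l" using l by (intro exI[of _ N]) (simp add: field_simps)
  define m where "m = (LEAST m. d \<le> 2 ^ m * l)"
  have m: "d \<le> 2 ^ m * l" unfolding m_def using ex by (rule LeastI_ex)
  \<comment> \<open>minimality of m gives d > 2^(m-1) l unless m = 0\<close>
  have far: "(l + d) powr (- \<eta>) \<le> 2 * (2 ^ m * l) powr (- \<eta>)"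
  proof (cases m)
    case 0
    have "(l + d) powr (- \<eta>) \<le> l powr (- \<eta>)" using l \<eta> by (intro powr_mono2') (auto simp: d_def)
    also have "\<dots> \<le> 2 * (2 ^ m * l) powr (- \<eta>)" using 0 by simp
    finally show ?thesis .
  next
    case (Suc k)
    then have "\<not> d \<le> 2 ^ k * l" unfolding m_def using not_less_Least[of k "\<lambda>m. d \<le> 2 ^ m * l"] by simp
    then have "(l + d) powr (- \<eta>) \<le> (2 ^ k * l) powr (- \<eta>)" using l \<eta> by (intro powr_mono2') auto
    also have "\<dots> = 2 powr \<eta> * (2 ^ m * l) powr (- \<eta>)"
      using l Suc by (simp add: powr_mult powr_minus field_simps)
    also have "\<dots> \<le> 2 * (2 ^ m * l) powr (- \<eta>)"
      using powr_mono[of \<eta> 1 2] \<eta> by (intro mult_right_mono) auto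
    finally show ?thesis .
  qed
  have "cube_weight \<eta> l c x = decay_weight \<eta> l (c $ i) (x $ i) * (\<Prod>j\<in>UNIV - {i}. decay_weight \<eta> l (c $ j) (x $ j))"
    unfolding cube_weight_def by (rule prod.remove) auto
  also have "\<dots> \<le> ennreal (2 * (2 ^ m * l) powr (- \<eta>)) * (\<Prod>j\<in>UNIV - {i}. ennreal (l powr (- \<eta>)))"
    using far l \<eta> unfolding decay_weight_def d_def[symmetric]
    by (intro mult_mono prod_mono_ennreal ennreal_leI powr_mono2') auto
  also have "(\<Prod>j\<in>UNIV - {i}. ennreal (l powr (- \<eta>))) = ennreal (l powr (- (real CARD('n) - 1) * \<eta>))"
  proof -
    have "(\<Prod>j\<in>UNIV - {i}. ennreal (l powr (- \<eta>))) = ennreal ((l powr (- \<eta>)) ^ (CARD('n) - 1))"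
      by (simp add: ennreal_power card_Diff_singleton)
    also have "(l powr (- \<eta>)) ^ (CARD('n) - 1) = l powr (- (real CARD('n) - 1) * \<eta>)"
      using l by (simp add: powr_powr of_nat_diff Suc_leI algebra_simps flip: powr_realpow)
    finally show ?thesis .
  qed
  also have "ennreal (2 * (2 ^ m * l) powr (- \<eta>)) * ennreal (l powr (- (real CARD('n) - 1) * \<eta>)) = ?s m"
  proof -
    have "x \<in> cbox (\<chi> i. c $ i - 2 ^ m * l) (\<chi> i. (c $ i - 2 ^ m * l) + 2 * (2 ^ m * l))"
      unfolding mem_box_cart
    proof
      fix j show "(\<chi> i. c $ i - 2 ^ m * l) $ j \<le> x $ j \<and> x $ j \<le> (\<chi> i. (c $ i - 2 ^ m * l) + 2 * (2 ^ m * l)) $ j"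
        using order_trans[OF i[of j] m[unfolded d_def]] by (auto simp: abs_le_iff algebra_simps)
    qed
    then show ?thesis by (simp add: mult.commute flip: ennreal_mult)
  qed
  also have "\<dots> \<le> (\<Sum>m. ?s m)" by (rule ennreal_le_suminf)
  finally show ?thesis .
qed

text \<open>
  The integral of \<open>\<Phi>\<close> over the \<open>m\<close>-th cube grows like \<open>2\<close> to the power \<open>m \<beta>\<close>, the weight there
  decays like \<open>2\<close> to the power \<open>- m \<eta>\<close>; the series converges since \<open>\<beta> < \<eta>\<close>.
\<close>

lemma cube_weight_integral_bound:
  assumes \<eta>: "0 < \<eta>" "\<eta> < 1" and \<beta>: "\<beta> < \<eta>"
  shows "\<exists>C>0. \<forall>\<Phi> \<Lambda> l. \<forall>c :: real^'n::finite. \<Phi> \<in> borel_measurable borel \<longrightarrow> 0 < l \<longrightarrow>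
    (\<forall>a l. 0 < l \<longrightarrow> (\<integral>\<^sup>+x\<in>cbox a (\<chi> i. a $ i + l). \<Phi> x \<partial>lborel) \<le> \<Lambda> * ennreal (l powr \<beta>)) \<longrightarrow>
    (\<integral>\<^sup>+x. \<Phi> x * cube_weight \<eta> l c x \<partial>lborel) \<le> ennreal (C * l powr (\<beta> - real CARD('n) * \<eta>)) * \<Lambda>"
proof -
  define \<rho> where "\<rho> = 2 powr (\<beta> - \<eta>)"
  have \<rho>: "0 < \<rho>" "\<rho> < 1" using \<beta> powr_less_mono[of "\<beta> - \<eta>" 0 2] by (auto simp: \<rho>_def)
  define C where "C = 2 * 2 powr \<beta> * (1 / (1 - \<rho>))"
  have C: "0 < C" using \<rho> by (simp add: C_def)
  have "(\<integral>\<^sup>+x. \<Phi> x * cube_weight \<eta> l c x \<partial>lborel) \<le> ennreal (C * l powr (\<beta> - real CARD('n) * \<eta>)) * \<Lambda>"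
    if [measurable]: "\<Phi> \<in> borel_measurable borel" and l: "0 < l"
      and growth: "\<And>a l. 0 < l \<Longrightarrow> (\<integral>\<^sup>+x\<in>cbox a (\<chi> i. a $ i + l). \<Phi> x \<partial>lborel) \<le> \<Lambda> * ennreal (l powr \<beta>)"
    for \<Phi> \<Lambda> l and c :: "real^'n"
  proof -
    define s where "s m = l powr (- (real CARD('n) - 1) * \<eta>) * (2 * (2 ^ m * l) powr (- \<eta>))" for m :: nat
    define Q where "Q m = cbox (\<chi> i. c $ i - 2 ^ m * l) (\<chi> i. (c $ i - 2 ^ m * l) + 2 * (2 ^ m * l))" for m :: nat
    have [measurable]: "Q m \<in> sets borel" for m by (simp add: Q_def)
    have s_nonneg: "0 \<le> s m" for m by (simp add: s_def)
    have "(\<integral>\<^sup>+x. \<Phi> x * cube_weight \<eta> l c x \<partial>lborel) \<le> (\<integral>\<^sup>+x. \<Phi> x * (\<Sum>m. ennreal (s m) * indicator (Q m) x) \<partial>lborel)"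
      unfolding s_def Q_def by (intro nn_integral_mono mult_left_mono cube_weight_shell_bound \<eta> l) auto
    also have "\<dots> = (\<integral>\<^sup>+x. (\<Sum>m. ennreal (s m) * (\<Phi> x * indicator (Q m) x)) \<partial>lborel)"
      by (intro nn_integral_cong) (simp add: mult.left_commute flip: ennreal_suminf_cmult)
    also have "\<dots> = (\<Sum>m. ennreal (s m) * (\<integral>\<^sup>+x\<in>Q m. \<Phi> x \<partial>lborel))"
      by (subst nn_integral_suminf) (auto simp: nn_integral_cmult)
    also have "\<dots> \<le> (\<Sum>m. ennreal (2 * 2 powr \<beta> * l powr (\<beta> - real CARD('n) * \<eta>)) * \<Lambda> * ennreal (\<rho> ^ m))"
    proof (intro suminf_le)
      fix m
      have "(\<integral>\<^sup>+x\<in>Q m. \<Phi> x \<partial>lborel) \<le> \<Lambda> * ennreal ((2 * (2 ^ m * l)) powr \<beta>)"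
        using growth[of "2 * (2 ^ m * l)" "\<chi> i. c $ i - 2 ^ m * l"] l unfolding Q_def by simp
      then have "ennreal (s m) * (\<integral>\<^sup>+x\<in>Q m. \<Phi> x \<partial>lborel) \<le> ennreal (s m) * (\<Lambda> * ennreal ((2 * (2 ^ m * l)) powr \<beta>))"
        by (rule mult_left_mono) simp
      also have "\<dots> = ennreal (s m * (2 * (2 ^ m * l)) powr \<beta>) * \<Lambda>"
        using s_nonneg[of m] by (simp add: ennreal_mult ac_simps)
      also have "s m * (2 * (2 ^ m * l)) powr \<beta> = 2 * 2 powr \<beta> * l powr (\<beta> - real CARD('n) * \<eta>) * \<rho> ^ m"
      proof -
        have "\<rho> ^ m = (2 ^ m) powr (\<beta> - \<eta>)"
          unfolding \<rho>_def by (simp add: powr_powr mult.commute flip: powr_realpow)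
        moreover have "l powr (- (real CARD('n) - 1) * \<eta>) * l powr (- \<eta>) * l powr \<beta> = l powr (\<beta> - real CARD('n) * \<eta>)"
          by (simp add: algebra_simps flip: powr_add)
        ultimately show ?thesis
          using l unfolding s_def
          by (simp add: powr_mult powr_add[symmetric] powr_diff powr_minus field_simps)
      qed
      finally show "ennreal (s m) * (\<integral>\<^sup>+x\<in>Q m. \<Phi> x \<partial>lborel)
          \<le> ennreal (2 * 2 powr \<beta> * l powr (\<beta> - real CARD('n) * \<eta>)) * \<Lambda> * ennreal (\<rho> ^ m)"
        using \<rho> by (simp add: ennreal_mult ac_simps)
    qed auto
    also have "\<dots> = ennreal (2 * 2 powr \<beta> * l powr (\<beta> - real CARD('n) * \<eta>)) * \<Lambda> * ennreal (1 / (1 - \<rho>))"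
      using \<rho> geometric_sums[of \<rho>] by (subst ennreal_suminf_cmult) (subst suminf_ennreal_eq, auto)
    also have "\<dots> = ennreal (C * l powr (\<beta> - real CARD('n) * \<eta>)) * \<Lambda>"
    proof -
      have "ennreal (C * l powr (\<beta> - real CARD('n) * \<eta>))
          = ennreal (2 * 2 powr \<beta> * l powr (\<beta> - real CARD('n) * \<eta>)) * ennreal (1 / (1 - \<rho>))"
        using \<rho> by (subst ennreal_mult[symmetric]) (auto simp: C_def)
      then show ?thesis by (simp only: ac_simps)
    qed
    finally show ?thesis .
  qed
  then show ?thesis using C by blast
qed

lemma cube_weight_lower:
  fixes a :: "real^'n::finite"
  assumes \<eta>: "0 < \<eta>" and l: "0 < l" and x: "x \<in> cbox a (\<chi> i. a $ i + l)"
  shows "ennreal ((2 * l) powr (- (real CARD('n) * \<eta>))) \<le> cube_weight \<eta> l a x"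
proof -
  have "ennreal ((2 * l) powr (- (real CARD('n) * \<eta>))) = (\<Prod>i\<in>(UNIV :: 'n set). ennreal ((2 * l) powr (- \<eta>)))"
    using l by (simp add: ennreal_power powr_powr mult.commute flip: powr_realpow)
  also have "\<dots> \<le> cube_weight \<eta> l a x"
    unfolding cube_weight_def decay_weight_def
  proof (intro prod_mono_ennreal ennreal_leI powr_mono2')
    fix i show "l + \<bar>x $ i - a $ i\<bar> \<le> 2 * l" using x by (auto simp: mem_box_cart abs_le_iff dest: spec[of _ i])
  qed (use \<eta> l in auto)
  finally show ?thesis .
qed

text \<open>
  Modification on a null set by the value \<open>\<infinity>\<close>. A pointwise majorant, rather than a function that
  agrees almost everywhere, is required because maximal operators see the values on single
  lines.
\<close>

lemma borel_majorant:
  fixes f :: "'a::euclidean_space \<Rightarrow> ennreal"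
  assumes "f \<in> borel_measurable lebesgue"
  shows "\<exists>g\<in>borel_measurable borel. (\<forall>x. f x \<le> g x) \<and> (AE x in lborel. f x = g x)"
proof -
  obtain g where g: "g \<in> borel_measurable lborel" and ae: "AE x in lborel. f x = g x"
    using completion_ex_borel_measurable[OF assms] by blast
  obtain N where N: "N \<in> null_sets lborel" "{x. f x \<noteq> g x} \<subseteq> N"
    using ae by (auto simp: eventually_ae_filter)
  have [measurable]: "g \<in> borel_measurable borel" "N \<in> sets borel" using g N by auto
  show ?thesis
  proof (intro bexI conjI allI)
    show "f x \<le> (if x \<in> N then top else g x)" for x using N(2) by (cases "f x = g x") auto
    show "AE x in lborel. f x = (if x \<in> N then top else g x)"
      using ae AE_not_in[OF N(1)] by eventually_elim auto
    show "(\<lambda>x. if x \<in> N then top else g x) \<in> borel_measurable borel" by measurable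
  qed
qed

theorem corollary1p10:
  fixes p q t :: real and u :: ennreal
  assumes "0 < u"
    and "0 < p"
    and "(real CARD('n::{finite,linorder}) - 1) / real CARD('n::{finite,linorder}) * p < q"
    and "q \<le> p"
    and "0 < t"
    and "ennreal t < min (ennreal q) u"
  shows "\<exists>C::real. 0 < C \<and>
    (\<forall>f :: nat \<Rightarrow> real^'n::{finite,linorder} \<Rightarrow> complex.
       (\<forall>j. f j \<in> morrey_space p q) \<longrightarrow>
       morrey_norm p q (\<lambda>x. ell_norm u (\<lambda>j. iter_maximal t (f j) x))
         \<le> ennreal C * morrey_norm p q (\<lambda>x. ell_norm u (\<lambda>j. ennreal (norm (f j x)))))"
proof -
  let ?n = "real CARD('n::{finite,linorder})"
  have tq: "t < q" and tu: "ennreal t < u"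
    using assms(5,6) by (auto simp: ennreal_less_iff)
  have q: "0 < q" using tq assms(5) by simp
  define r where "r = q / t"
  have r: "1 < r" using tq assms(5) by (simp add: r_def)
  define U where "U = u / ennreal t"
  have U: "1 < U"
  proof (cases u)
    case (real v)
    then show ?thesis using tu assms(5)
      by (auto simp: U_def divide_ennreal ennreal_less_iff simp flip: ennreal_1)
  qed (use assms(5) in \<open>simp add: U_def ennreal_top_divide\<close>)
  have U0: "0 < U" using U by (rule less_trans[rotated]) simp
  define \<beta> where "\<beta> = ?n * (1 - q / p)"
  have n: "1 \<le> ?n" by (simp add: Suc_leI)
  have \<beta>: "0 \<le> \<beta>" "\<beta> < 1"
    using assms(2,3,4) n by (auto simp: \<beta>_def field_simps)
  define \<eta> where "\<eta> = (\<beta> + 1) / 2"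
  have \<eta>: "0 < \<eta>" "\<eta> < 1" "\<beta> < \<eta>" using \<beta> by (auto simp: \<eta>_def)
  define ks where "ks = sorted_list_of_set (UNIV :: 'n::{finite,linorder} set)"
  obtain C where C: "0 < C" and weighted: "\<forall>l c. \<forall>G :: nat \<Rightarrow> real^'n::{finite,linorder} \<Rightarrow> ennreal. 0 < l \<longrightarrow> (\<forall>j. G j \<in> borel_measurable borel) \<longrightarrow>
    (\<integral>\<^sup>+x. ennpowr (ell_norm U (\<lambda>j. fold dir_maximal_rat ks (G j) x)) r * cube_weight \<eta> l c x \<partial>lborel)
      \<le> ennreal C * (\<integral>\<^sup>+x. ennpowr (ell_norm U (\<lambda>j. G j x)) r * cube_weight \<eta> l c x \<partial>lborel)"
    using fold_dir_maximal_rat_weighted[OF r U \<eta>(1,2), of ks] by blast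
  obtain C' where C': "0 < C'" and growth: "\<forall>\<Phi> \<Lambda> l. \<forall>c :: real^'n::{finite,linorder}. \<Phi> \<in> borel_measurable borel \<longrightarrow> 0 < l \<longrightarrow>
    (\<forall>a l. 0 < l \<longrightarrow> (\<integral>\<^sup>+x\<in>cbox a (\<chi> i. a $ i + l). \<Phi> x \<partial>lborel) \<le> \<Lambda> * ennreal (l powr \<beta>)) \<longrightarrow>
    (\<integral>\<^sup>+x. \<Phi> x * cube_weight \<eta> l c x \<partial>lborel) \<le> ennreal (C' * l powr (\<beta> - ?n * \<eta>)) * \<Lambda>"
    using cube_weight_integral_bound[OF \<eta>] by blast
  define D where "D = 2 powr (?n * \<eta>) * C * C'"
  have D: "0 < D" using C C' by (simp add: D_def)
  show ?thesis
  proof (intro exI[of _ "D powr (1 / q)"] conjI allI impI)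
    show "0 < D powr (1 / q)" using D by simp
  next
    fix f :: "nat \<Rightarrow> real^'n::{finite,linorder} \<Rightarrow> complex"
    assume f: "\<forall>j. f j \<in> morrey_space p q"
    define F where "F j x = ennreal (norm (f j x) powr t)" for j x
    have F_eq: "F j x = ennpowr (ennreal (norm (f j x))) t" for j x
      by (simp add: F_def ennpowr_ennreal)
    define N where "N = morrey_norm p q (\<lambda>x. ell_norm u (\<lambda>j. ennreal (norm (f j x))))"
    have "F j \<in> borel_measurable lebesgue" for j
    proof -
      have [measurable]: "f j \<in> borel_measurable lebesgue" using f by (simp add: morrey_space_def)
      show ?thesis unfolding F_def by measurable
    qed
    then have "\<forall>j. \<exists>g. g \<in> borel_measurable borel \<and> (\<forall>x. F j x \<le> g x) \<and> (AE x in lborel. F j x = g x)"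
      using borel_majorant by blast
    from choice[OF this] obtain G where
      "\<forall>j. G j \<in> borel_measurable borel \<and> (\<forall>x. F j x \<le> G j x) \<and> (AE x in lborel. F j x = G j x)" ..
    then have G: "\<And>j. G j \<in> borel_measurable borel" "\<And>j x. F j x \<le> G j x"
      "\<And>j. AE x in lborel. F j x = G j x" by auto
    note [measurable] = G(1)
    define \<Phi> where "\<Phi> x = ennpowr (ell_norm U (\<lambda>j. G j x)) r" for x
    define \<Psi> where "\<Psi> x = ennpowr (ell_norm U (\<lambda>j. fold dir_maximal_rat ks (G j) x)) r" for x
    have [measurable]: "\<Phi> \<in> borel_measurable borel" unfolding \<Phi>_def by measurable
    have fold_meas: "fold dir_maximal_rat ks' g \<in> borel_measurable borel" if "g \<in> borel_measurable borel"
      for g :: "real^'n::{finite,linorder} \<Rightarrow> ennreal" and ks'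
      using that by (induction ks' arbitrary: g) (auto intro: dir_maximal_rat_measurable)
    note [measurable] = fold_meas[OF G(1)]
    have [measurable]: "\<Psi> \<in> borel_measurable borel" unfolding \<Psi>_def by measurable
    have rhs: "AE x in lborel. ennpowr (ell_norm u (\<lambda>j. ennreal (norm (f j x)))) q = \<Phi> x"
    proof -
      have "AE x in lborel. \<forall>j. F j x = G j x" using G(3) by (simp add: AE_all_countable)
      then show ?thesis
      proof eventually_elim
        case (elim x)
        have "ell_norm u (\<lambda>j. ennreal (norm (f j x))) = ell_norm u (\<lambda>j. ennpowr (F j x) (1 / t))"
          using assms(5) by (simp add: F_eq ennpowr_ennpowr)
        also have "\<dots> = ennpowr (ell_norm U (\<lambda>j. F j x)) (1 / t)"
          unfolding U_def by (rule ell_norm_ennpowr[OF assms(5,1)])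
        finally show ?case using elim by (simp add: \<Phi>_def r_def ennpowr_ennpowr)
      qed
    qed
    have lhs: "ennpowr (ell_norm u (\<lambda>j. iter_maximal t (f j) x)) q \<le> \<Psi> x" for x
    proof -
      have "ell_norm u (\<lambda>j. iter_maximal t (f j) x) = ennpowr (ell_norm U (\<lambda>j. fold dir_maximal ks (F j) x)) (1 / t)"
        unfolding U_def iter_maximal_def ks_def F_def by (rule ell_norm_ennpowr[OF assms(5,1)])
      also have "\<dots> \<le> ennpowr (ell_norm U (\<lambda>j. fold dir_maximal_rat ks (G j) x)) (1 / t)"
        using assms(5) by (intro ennpowr_mono ell_norm_mono U0 fold_dir_maximal_le_rat G) auto
      finally have "ennpowr (ell_norm u (\<lambda>j. iter_maximal t (f j) x)) q
          \<le> ennpowr (ennpowr (ell_norm U (\<lambda>j. fold dir_maximal_rat ks (G j) x)) (1 / t)) q"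
        using q by (intro ennpowr_mono) auto
      then show ?thesis by (simp add: \<Psi>_def r_def ennpowr_ennpowr)
    qed
    have \<Phi>_growth: "(\<integral>\<^sup>+x\<in>cbox a (\<chi> i. a $ i + l). \<Phi> x \<partial>lborel) \<le> ennpowr N q * ennreal (l powr \<beta>)"
      if "0 < l" for a l
    proof -
      have "(\<integral>\<^sup>+x\<in>cbox a (\<chi> i. a $ i + l). \<Phi> x \<partial>lborel)
          = (\<integral>\<^sup>+x\<in>cbox a (\<chi> i. a $ i + l). ennpowr (ell_norm u (\<lambda>j. ennreal (norm (f j x)))) q \<partial>lborel)"
        by (rule nn_integral_cong_AE) (use rhs in eventually_elim, auto)
      also have "\<dots> \<le> ennpowr N q * ennreal (l powr \<beta>)"
        unfolding N_def \<beta>_def by (rule morrey_norm_cube_bound[OF q that])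
      finally show ?thesis .
    qed
    show "morrey_norm p q (\<lambda>x. ell_norm u (\<lambda>j. iter_maximal t (f j) x))
        \<le> ennreal (D powr (1 / q)) * morrey_norm p q (\<lambda>x. ell_norm u (\<lambda>j. ennreal (norm (f j x))))"
      unfolding N_def[symmetric]
    proof (rule morrey_norm_least[OF q])
      fix a :: "real^'n::{finite,linorder}" and l :: real assume l: "0 < l"
      let ?Q = "cbox a (\<chi> i. a $ i + l)" and ?W = "cube_weight \<eta> l a"
      have "(\<integral>\<^sup>+x\<in>?Q. ennpowr (ell_norm u (\<lambda>j. iter_maximal t (f j) x)) q \<partial>lborel)
          \<le> (\<integral>\<^sup>+x. ennreal ((2 * l) powr (?n * \<eta>)) * (\<Psi> x * ?W x) \<partial>lborel)"
      proof (rule nn_integral_mono)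
        fix x
        show "ennpowr (ell_norm u (\<lambda>j. iter_maximal t (f j) x)) q * indicator ?Q x
            \<le> ennreal ((2 * l) powr (?n * \<eta>)) * (\<Psi> x * ?W x)"
        proof (cases "x \<in> ?Q")
          case True
          have "1 = ennreal ((2 * l) powr (?n * \<eta>)) * ennreal ((2 * l) powr (- (?n * \<eta>)))"
            using l by (simp flip: ennreal_mult powr_add)
          also have "\<dots> \<le> ennreal ((2 * l) powr (?n * \<eta>)) * ?W x"
            by (intro mult_left_mono cube_weight_lower True \<eta> l) simp
          finally have "ennpowr (ell_norm u (\<lambda>j. iter_maximal t (f j) x)) q * 1
              \<le> \<Psi> x * (ennreal ((2 * l) powr (?n * \<eta>)) * ?W x)"
            by (intro mult_mono lhs) auto
          then show ?thesis using True by (simp add: mult.left_commute)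
        qed simp
      qed
      also have "\<dots> = ennreal ((2 * l) powr (?n * \<eta>)) * (\<integral>\<^sup>+x. \<Psi> x * ?W x \<partial>lborel)"
        by (rule nn_integral_cmult) measurable
      also have "\<dots> \<le> ennreal ((2 * l) powr (?n * \<eta>)) * (ennreal C * (\<integral>\<^sup>+x. \<Phi> x * ?W x \<partial>lborel))"
        unfolding \<Phi>_def \<Psi>_def using l G(1) by (intro mult_left_mono weighted[rule_format]) auto
      also have "\<dots> \<le> ennreal ((2 * l) powr (?n * \<eta>)) * (ennreal C * (ennreal (C' * l powr (\<beta> - ?n * \<eta>)) * ennpowr N q))"
        using l \<Phi>_growth by (intro mult_left_mono growth[rule_format]) auto
      also have "\<dots> = ennreal ((2 * l) powr (?n * \<eta>) * (C * (C' * l powr (\<beta> - ?n * \<eta>)))) * ennpowr N q"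
        using C C' by (simp add: ennreal_mult mult.assoc)
      also have "(2 * l) powr (?n * \<eta>) * (C * (C' * l powr (\<beta> - ?n * \<eta>))) = D * l powr \<beta>"
        using l by (simp add: D_def powr_mult powr_diff)
      also have "ennreal (D * l powr \<beta>) * ennpowr N q = ennpowr (ennreal (D powr (1 / q)) * N) q * ennreal (l powr \<beta>)"
        using D q by (simp add: ennpowr_mult ennpowr_ennreal powr_powr ennreal_mult ac_simps)
      finally show "(\<integral>\<^sup>+x\<in>?Q. ennpowr (ell_norm u (\<lambda>j. iter_maximal t (f j) x)) q \<partial>lborel)
          \<le> ennpowr (ennreal (D powr (1 / q)) * N) q * ennreal (l powr (?n * (1 - q / p)))"
        by (simp add: \<beta>_def)
    qed
  qed
qed

end
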